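(* Let $M$ be a metric space, and $X_1,X_2,\ldots$ an i.i.d. sequence of $M$-valued random variables. Let $k\in\mathbb{N}_0$ and put $P_n=\{X_1,X_2,\ldots,X_n\}$. If the distribution of the $X_i$ has support equal to a compact subset $C\subset M$, and if $T:\hat{\mathcal{B}}_\infty\to V$ is a continuous map to a Banach space $V$ of type $2$, then $$T(\beta_k(C))=\lim_{n\to\infty}\mathbb{E}[T(\beta_k(P_n))].$$
   Context: The support of a measure $\mu$ on a $\sigma$-algebra containing the Borel $\sigma$-algebra of $M$ is $\operatorname{supp}(\mu)=\{x\in M:\ \mu(B_\varepsilon(x))>0\ \text{for all }\varepsilon>0\}$, with $B_\varepsilon(x)$ the open ball. Homology has coefficients in a fixed field $\mathbf{k}$; reduced homology is $\tilde H_k(X)=\ker(H_k(X)\to H_k(\mathrm{pt}))$. Persistent homology: for a metric space $(M,d)$, a finite nonempty $P\subset M$ and $t\ge 0$, the Čech complex $\check C_t(P)$ is the abstract simplicial complex with vertex set $P$ in which $\{x_0,\dots,x_j\}$ spans a simplex iff $\bigcap_{i}\overline B_t(x_i)\neq\emptyset$, where $\overline B_t(x)=\{y\in M: d(x,y)\le t\}$. The persistence module $\mathrm{PH}_k(P)$ has $\mathrm{PH}_k(P)_t=\tilde H_k(\check C_t(P))$ for $t\ge 0$, with maps induced by inclusions. It is a direct sum of finitely many interval modules (an interval module is $\mathbf{k}$ on an interval and $0$ outside, with identity maps inside), all of finite length; the multiset of these intervals is the barcode of $\mathrm{PH}_k(P)$. Barcode space: $\mathcal{B}$ is the set of finite multisets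 of pairs $(x,d)\in\mathbb{R}_{\ge0}^2$ (an interval with left endpoint $x$ and length $d$), where two multisets are identified if they agree after deleting pairs with $d=0$. $\beta_k(P)\in\mathcal{B}$ is the multiset of pairs (left endpoint, length) of the intervals in the barcode of $\mathrm{PH}_k(P)$. Bottleneck distance: put $d_\infty((x_1,d_1),(x_2,d_2))=\max(|x_1-x_2|,|(x_1+d_1)-(x_2+d_2)|)$ and $d_\infty((x,d),\Delta)=d/2$. For $b_1=\{I_i\}_{i=1}^n$, $b_2=\{J_j\}_{j=1}^m$, $d_\infty(b_1,b_2)$ is the minimum over all bijections $\theta:A\to B$ with $A\subset\{1,\dots,n\}$, $B\subset\{1,\dots,m\}$ of $\max\big(\max_{a\in A}d_\infty(I_a,J_{\theta(a)}),\max_{a\notin A}d_\infty(I_a,\Delta),\max_{b\notin B}d_\infty(J_b,\Delta)\big)$. $\hat{\mathcal{B}}_\infty$ is the completion of $(\mathcal{B},d_\infty)$. Barcodes of compact sets: let $K(M)$ be the set of nonempty compact subsets of $M$ with the Hausdorff distance $d_H(A,B)=\max(\inf\{t\ge0: A\subset B_t\},\inf\{t\ge0:B\subset A_t\})$, where $A_t=\{x\in M: d(x,A)\le t\}$. The map $\beta_k$ on finite nonempty subsets is $1$-Lipschitz from $d_H$ to $d_\infty$, and $\beta_k:K(M)\to\hat{\mathcal{B}}_\infty$ denotes its unique continuous extension (also $1$-Lipschitz). Expectation of a $V$-valued random variable $\xi$ is its Pettis integral: the element $v=\mathbb{E}[\xi]\in V$ with $\varphi(v)=\mathbb{E}[\varphi(\xi)]$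 for every continuous linear functional $\varphi$ on $V$. Type $2$: a Banach space $V$ is of type $2$ if for every Rademacher sequence $(\varepsilon_i)$ (independent random variables with values $\pm1$, each with probability $1/2$) there is a constant $C$ such that $\big(\mathbb{E}\|\sum_i\varepsilon_ix_i\|^2\big)^{1/2}\le C\big(\sum_i\|x_i\|^2\big)^{1/2}$ for all finite sequences $(x_i)$ in $V$.
   Formalization: The random variables are additionally assumed to lie almost surely in a separable subset of M (automatic for separable M); otherwise, if a real-valued measurable cardinal exists, the law need not be concentrated on its support C and the claim fails. Expectations use the completed measure. *)

theory Defs
  imports
    "HOL-Probability.Probability"
    "HOL-Combinatorics.Permutations"
    "HOL-Library.Function_Algebras"
    "HOL-Library.Set_Algebras"
begin

section \<open>Barcodes and the bottleneck distance\<close>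

text \<open>A bar is a pair (left endpoint, length).\<close>

type_synonym bar = "real \<times> real"

definition bar_equiv :: "bar multiset \<Rightarrow> bar multiset \<Rightarrow> bool" where
  "bar_equiv b b' \<longleftrightarrow>
     (\<forall>(x, d) \<in># b + b'. 0 \<le> x \<and> 0 \<le> d) \<and>
     filter_mset (\<lambda>(x, d). d \<noteq> 0) b = filter_mset (\<lambda>(x, d). d \<noteq> 0) b'"

quotient_type barcode = "bar multiset" / partial: bar_equiv
proof (rule part_equivpI)
  show "\<exists>b. bar_equiv b b" by (rule exI[of _ "{#}"]) (simp add: bar_equiv_def)
  show "symp bar_equiv" by (auto simp: symp_def bar_equiv_def)
  show "transp bar_equiv" by (auto simp: transp_def bar_equiv_def)
qed

fun bar_dist :: "bar \<Rightarrow> bar \<Rightarrow> real" where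
  "bar_dist (x\<^sub>1, d\<^sub>1) (x\<^sub>2, d\<^sub>2) = max \<bar>x\<^sub>1 - x\<^sub>2\<bar> \<bar>(x\<^sub>1 + d\<^sub>1) - (x\<^sub>2 + d\<^sub>2)\<bar>"

fun diag_dist :: "bar \<Rightarrow> real" where
  "diag_dist (x, d) = d / 2"

definition partial_matching :: "bar list \<Rightarrow> bar list \<Rightarrow> nat set \<Rightarrow> (nat \<Rightarrow> nat) \<Rightarrow> bool" where
  "partial_matching xs ys A \<theta> \<longleftrightarrow>
     A \<subseteq> {..<length xs} \<and> inj_on \<theta> A \<and> \<theta> ` A \<subseteq> {..<length ys}"

text \<open>The element 0 only fixes the maximum over the empty set.\<close>

definition matching_cost :: "bar list \<Rightarrow> bar list \<Rightarrow> nat set \<Rightarrow> (nat \<Rightarrow> nat) \<Rightarrow> real" where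
  "matching_cost xs ys A \<theta> = Max ({0}
     \<union> (\<lambda>a. bar_dist (xs ! a) (ys ! \<theta> a)) ` A
     \<union> (\<lambda>a. diag_dist (xs ! a)) ` ({..<length xs} - A)
     \<union> (\<lambda>b. diag_dist (ys ! b)) ` ({..<length ys} - \<theta> ` A))"

text \<open>The infimum runs over all enumerations of the two multisets as indexed families; the set of
  costs is finite and does not depend on the enumerations, so the infimum is a minimum.\<close>

definition bottleneck :: "bar multiset \<Rightarrow> bar multiset \<Rightarrow> real" where
  "bottleneck b b' = Inf {matching_cost xs ys A \<theta> | xs ys A \<theta>.
     mset xs = b \<and> mset ys = b' \<and> partial_matching xs ys A \<theta>}"

subsection \<open>The bottleneck distance is a metric on barcodes\<close>

definition match_le :: "real \<Rightarrow> bar list \<Rightarrow> bar list \<Rightarrow> (nat \<times> nat) set \<Rightarrow> bool" where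
  "match_le r xs ys R \<longleftrightarrow> R \<subseteq> {..<length xs} \<times> {..<length ys}
     \<and> (\<forall>a b b'. (a, b) \<in> R \<longrightarrow> (a, b') \<in> R \<longrightarrow> b = b')
     \<and> (\<forall>a a' b. (a, b) \<in> R \<longrightarrow> (a', b) \<in> R \<longrightarrow> a = a')
     \<and> (\<forall>a b. (a, b) \<in> R \<longrightarrow> bar_dist (xs ! a) (ys ! b) \<le> r)
     \<and> (\<forall>a < length xs. (\<forall>b. (a, b) \<notin> R) \<longrightarrow> diag_dist (xs ! a) \<le> r)
     \<and> (\<forall>b < length ys. (\<forall>a. (a, b) \<notin> R) \<longrightarrow> diag_dist (ys ! b) \<le> r)"

lemma bar_dist_commute: "bar_dist p q = bar_dist q p"
  by (cases p; cases q) auto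

lemma bar_dist_nonneg: "0 \<le> bar_dist p q"
  by (cases p; cases q) auto

lemma bar_dist_triangle: "bar_dist p r \<le> bar_dist p q + bar_dist q r"
  by (cases p; cases q; cases r) (auto simp: max_def)

lemma diag_dist_triangle: "diag_dist p \<le> bar_dist p q + diag_dist q"
proof (cases p; cases q)
  fix x d y e assume "p = (x, d)" "q = (y, e)"
  then show ?thesis by (simp add: max_def abs_if)
qed

lemma match_le_sym: "match_le r xs ys R \<Longrightarrow> match_le r ys xs (R\<inverse>)"
  unfolding match_le_def by (auto simp: bar_dist_commute)

lemma match_le_trans:
  assumes R: "match_le r xs ys R" and S: "match_le s ys zs S"
    and r: "0 \<le> r" and s: "0 \<le> s"
  shows "match_le (r + s) xs zs (R O S)"
proof -
  have R1: "a < length xs" "b < length ys" if "(a, b) \<in> R" for a b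
    using R that unfolding match_le_def by auto
  have R2: "b = b'" if "(a, b) \<in> R" "(a, b') \<in> R" for a b b'
    using R that unfolding match_le_def by simp
  have R3: "a = a'" if "(a, b) \<in> R" "(a', b) \<in> R" for a a' b
    using R that unfolding match_le_def by simp
  have R4: "bar_dist (xs ! a) (ys ! b) \<le> r" if "(a, b) \<in> R" for a b
    using R that unfolding match_le_def by simp
  have R5: "diag_dist (xs ! a) \<le> r" if "a < length xs" "\<And>b. (a, b) \<notin> R" for a
    using R that unfolding match_le_def by simp
  have R6: "diag_dist (ys ! b) \<le> r" if "b < length ys" "\<And>a. (a, b) \<notin> R" for b
    using R that unfolding match_le_def by simp
  have S1: "a < length ys" "b < length zs" if "(a, b) \<in> S" for a b
    using S that unfolding match_le_def by auto
  have S2: "b = b'" if "(a, b) \<in> S" "(a, b') \<in> S" for a b b'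
    using S that unfolding match_le_def by simp
  have S3: "a = a'" if "(a, b) \<in> S" "(a', b) \<in> S" for a a' b
    using S that unfolding match_le_def by simp
  have S4: "bar_dist (ys ! a) (zs ! b) \<le> s" if "(a, b) \<in> S" for a b
    using S that unfolding match_le_def by simp
  have S5: "diag_dist (ys ! a) \<le> s" if "a < length ys" "\<And>b. (a, b) \<notin> S" for a
    using S that unfolding match_le_def by simp
  have S6: "diag_dist (zs ! b) \<le> s" if "b < length zs" "\<And>a. (a, b) \<notin> S" for b
    using S that unfolding match_le_def by simp
  show ?thesis
    unfolding match_le_def
  proof (intro conjI allI impI)
    show "R O S \<subseteq> {..<length xs} \<times> {..<length zs}"
      using R1(1) S1(2) by auto
    show "b = b'" if bb: "(a, b) \<in> R O S" "(a, b') \<in> R O S" for a b b'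
    proof -
      obtain c where c: "(a, c) \<in> R" "(c, b) \<in> S" using bb(1) by (rule relcompE) simp
      obtain c' where c': "(a, c') \<in> R" "(c', b') \<in> S" using bb(2) by (rule relcompE) simp
      show ?thesis using S2[OF c(2)] R2[OF c(1) c'(1)] c'(2) by simp
    qed
    show "a = a'" if aa: "(a, b) \<in> R O S" "(a', b) \<in> R O S" for a a' b
    proof -
      obtain c where c: "(a, c) \<in> R" "(c, b) \<in> S" using aa(1) by (rule relcompE) simp
      obtain c' where c': "(a', c') \<in> R" "(c', b) \<in> S" using aa(2) by (rule relcompE) simp
      show ?thesis using R3[OF c(1)] S3[OF c(2) c'(2)] c'(1) by simp
    qed
    show "bar_dist (xs ! a) (zs ! b) \<le> r + s" if ab: "(a, b) \<in> R O S" for a b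
    proof -
      obtain c where c: "(a, c) \<in> R" "(c, b) \<in> S" using ab by (rule relcompE) simp
      show ?thesis
        using R4[OF c(1)] S4[OF c(2)] bar_dist_triangle[of "xs ! a" "zs ! b" "ys ! c"] by linarith
    qed
    show "diag_dist (xs ! a) \<le> r + s" if a: "a < length xs" "\<forall>b. (a, b) \<notin> R O S" for a
    proof (cases "\<exists>c. (a, c) \<in> R")
      case True
      then obtain c where c: "(a, c) \<in> R" ..
      then have "(c, b) \<notin> S" for b using a(2) by (meson relcompI)
      then have "diag_dist (ys ! c) \<le> s" using S5 R1(2)[OF c] by simp
      then show ?thesis using R4[OF c] diag_dist_triangle[of "xs ! a" "ys ! c"] by linarith
    next
      case False
      then show ?thesis using R5[OF a(1)] s by simp
    qed
    show "diag_dist (zs ! b) \<le> r + s" if b: "b < length zs" "\<forall>a. (a, b) \<notin> R O S" for b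
    proof (cases "\<exists>c. (c, b) \<in> S")
      case True
      then obtain c where c: "(c, b) \<in> S" ..
      then have "(a, c) \<notin> R" for a using b(2) by (meson relcompI)
      then have "diag_dist (ys ! c) \<le> r" using R6 S1(1)[OF c] by simp
      moreover have "bar_dist (zs ! b) (ys ! c) \<le> s" using S4[OF c] by (simp add: bar_dist_commute)
      ultimately show ?thesis using diag_dist_triangle[of "zs ! b" "ys ! c"] by linarith
    next
      case False
      then show ?thesis using S6[OF b(1)] r by simp
    qed
  qed
qed

lemma match_le_mset_eq:
  assumes "mset xs = mset ys"
  shows "\<exists>R. match_le 0 xs ys R"
proof -
  obtain p where p: "p permutes {..<length ys}" "permute_list p ys = xs"
    using assms mset_eq_permutation by metis
  have len: "length xs = length ys" using assms mset_eq_length by blast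
  have nth: "xs ! i = ys ! p i" if "i < length ys" for i
    using permute_list_nth[OF p(1) that] p(2) by simp
  have "match_le 0 xs ys {(i, p i) | i. i < length ys}"
    unfolding match_le_def
  proof (intro conjI allI impI)
    show "{(i, p i) | i. i < length ys} \<subseteq> {..<length xs} \<times> {..<length ys}"
      using permutes_in_image[OF p(1)] len by auto
    show "a = a'" if "(a, b) \<in> {(i, p i) | i. i < length ys}"
      "(a', b) \<in> {(i, p i) | i. i < length ys}" for a a' b
      using that permutes_inj[OF p(1)] by (auto dest: injD)
    show "bar_dist (xs ! a) (ys ! b) \<le> 0" if "(a, b) \<in> {(i, p i) | i. i < length ys}" for a b
    proof -
      have "xs ! a = ys ! b" using that nth by auto
      then show ?thesis by (cases "ys ! b") simp
    qed
    show "diag_dist (ys ! b) \<le> 0" if b: "b < length ys"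
      "\<forall>a. (a, b) \<notin> {(i, p i) | i. i < length ys}" for b
    proof -
      have "b \<in> p ` {..<length ys}" using permutes_image[OF p(1)] b(1) by simp
      then show ?thesis using b(2) by blast
    qed
  qed (use len in auto)
  then show ?thesis by blast
qed

lemma partial_matching_finite:
  assumes "partial_matching xs ys A \<theta>"
  shows "finite ({0::real}
     \<union> (\<lambda>a. bar_dist (xs ! a) (ys ! \<theta> a)) ` A
     \<union> (\<lambda>a. diag_dist (xs ! a)) ` ({..<length xs} - A)
     \<union> (\<lambda>b. diag_dist (ys ! b)) ` ({..<length ys} - \<theta> ` A))"
  using assms finite_subset[of A "{..<length xs}"] unfolding partial_matching_def by auto

lemma matching_cost_nonneg:
  assumes "partial_matching xs ys A \<theta>"
  shows "0 \<le> matching_cost xs ys A \<theta>"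
  unfolding matching_cost_def by (rule Max_ge[OF partial_matching_finite[OF assms]]) simp

lemma matching_cost_imp_match_le:
  assumes "partial_matching xs ys A \<theta>"
  shows "match_le (matching_cost xs ys A \<theta>) xs ys {(a, \<theta> a) | a. a \<in> A}"
proof -
  note M = Max_ge[OF partial_matching_finite[OF assms], folded matching_cost_def]
  show ?thesis
    unfolding match_le_def
  proof (intro conjI allI impI)
    show "{(a, \<theta> a) | a. a \<in> A} \<subseteq> {..<length xs} \<times> {..<length ys}"
      using assms unfolding partial_matching_def by auto
    show "a = a'" if "(a, b) \<in> {(a, \<theta> a) | a. a \<in> A}" "(a', b) \<in> {(a, \<theta> a) | a. a \<in> A}" for a a' b
      using that assms unfolding partial_matching_def by (auto dest: inj_onD)
    show "bar_dist (xs ! a) (ys ! b) \<le> matching_cost xs ys A \<theta>"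
      if "(a, b) \<in> {(a, \<theta> a) | a. a \<in> A}" for a b
      using that by (intro M) auto
    show "diag_dist (xs ! a) \<le> matching_cost xs ys A \<theta>"
      if "a < length xs" "\<forall>b. (a, b) \<notin> {(a, \<theta> a) | a. a \<in> A}" for a
      using that by (intro M) auto
    show "diag_dist (ys ! b) \<le> matching_cost xs ys A \<theta>"
      if "b < length ys" "\<forall>a. (a, b) \<notin> {(a, \<theta> a) | a. a \<in> A}" for b
      using that by (intro M) auto
  qed auto
qed

lemma match_le_imp_matching_cost:
  assumes R: "match_le r xs ys R" and r: "0 \<le> r"
  shows "\<exists>A \<theta>. partial_matching xs ys A \<theta> \<and> matching_cost xs ys A \<theta> \<le> r"
proof -
  define \<theta> where "\<theta> a = (THE b. (a, b) \<in> R)" for a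
  have th: "\<theta> a = b" if "(a, b) \<in> R" for a b
    unfolding \<theta>_def
  proof (rule the_equality)
    show "b' = b" if "(a, b') \<in> R" for b'
      using that \<open>(a, b) \<in> R\<close> R unfolding match_le_def by blast
  qed (fact that)
  have th': "(a, \<theta> a) \<in> R" if "a \<in> Domain R" for a
    using that th by blast
  have im: "\<theta> ` Domain R = Range R"
  proof
    show "\<theta> ` Domain R \<subseteq> Range R" using th' by blast
    show "Range R \<subseteq> \<theta> ` Domain R" using th by blast
  qed
  have pm: "partial_matching xs ys (Domain R) \<theta>"
    unfolding partial_matching_def im
  proof (intro conjI)
    show "Domain R \<subseteq> {..<length xs}" "Range R \<subseteq> {..<length ys}"
      using R unfolding match_le_def by blast+
    show "inj_on \<theta> (Domain R)"
    proof (rule inj_onI)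
      fix a a' assume "a \<in> Domain R" "a' \<in> Domain R" "\<theta> a = \<theta> a'"
      then have "(a, \<theta> a) \<in> R" "(a', \<theta> a) \<in> R" using th'[of a] th'[of a'] by simp_all
      then show "a = a'" using R unfolding match_le_def by blast
    qed
  qed
  have "matching_cost xs ys (Domain R) \<theta> \<le> r"
    unfolding matching_cost_def
  proof (rule Max.boundedI[OF partial_matching_finite[OF pm]])
    fix c assume c: "c \<in> {0} \<union> (\<lambda>a. bar_dist (xs ! a) (ys ! \<theta> a)) ` Domain R
       \<union> (\<lambda>a. diag_dist (xs ! a)) ` ({..<length xs} - Domain R)
       \<union> (\<lambda>b. diag_dist (ys ! b)) ` ({..<length ys} - \<theta> ` Domain R)"
    then consider "c = 0"
      | a where "a \<in> Domain R" "c = bar_dist (xs ! a) (ys ! \<theta> a)"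
      | a where "a < length xs" "a \<notin> Domain R" "c = diag_dist (xs ! a)"
      | b where "b < length ys" "b \<notin> Range R" "c = diag_dist (ys ! b)"
      unfolding im by blast
    then show "c \<le> r"
    proof cases
      case (2 a)
      then have "(a, \<theta> a) \<in> R" using th' by simp
      then show ?thesis using 2 R unfolding match_le_def by blast
    qed (use r R in \<open>auto simp: match_le_def\<close>)
  qed simp
  then show ?thesis using pm by blast
qed

abbreviation matching_costs :: "bar multiset \<Rightarrow> bar multiset \<Rightarrow> real set" where
  "matching_costs b b' \<equiv> {matching_cost xs ys A \<theta> | xs ys A \<theta>.
     mset xs = b \<and> mset ys = b' \<and> partial_matching xs ys A \<theta>}"

lemma finite_matching_costs: "finite (matching_costs b b')"
proof (rule finite_subset)
  let ?F = "{0} \<union> (\<lambda>(p, q). bar_dist p q) ` (set_mset b \<times> set_mset b')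
    \<union> diag_dist ` set_mset b \<union> diag_dist ` set_mset b'"
  show "finite ?F" by auto
  show "matching_costs b b' \<subseteq> ?F"
  proof
    fix c assume "c \<in> matching_costs b b'"
    then obtain xs ys A \<theta> where m: "mset xs = b" "mset ys = b'"
      and pm: "partial_matching xs ys A \<theta>" and c: "c = matching_cost xs ys A \<theta>"
      by blast
    have "c \<in> {0}
     \<union> (\<lambda>a. bar_dist (xs ! a) (ys ! \<theta> a)) ` A
     \<union> (\<lambda>a. diag_dist (xs ! a)) ` ({..<length xs} - A)
     \<union> (\<lambda>b. diag_dist (ys ! b)) ` ({..<length ys} - \<theta> ` A)"
      unfolding c matching_cost_def by (rule Max_in[OF partial_matching_finite[OF pm]]) simp
    then consider "c = 0" | a where "a \<in> A" "c = bar_dist (xs ! a) (ys ! \<theta> a)"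
      | a where "a < length xs" "c = diag_dist (xs ! a)"
      | b where "b < length ys" "c = diag_dist (ys ! b)"
      by auto
    then show "c \<in> ?F"
    proof cases
      case (2 a)
      then have "a < length xs" "\<theta> a < length ys"
        using pm unfolding partial_matching_def by auto
      then have "(xs ! a, ys ! \<theta> a) \<in> set_mset b \<times> set_mset b'" using m by auto
      then have "(\<lambda>(p, q). bar_dist p q) (xs ! a, ys ! \<theta> a)
        \<in> (\<lambda>(p, q). bar_dist p q) ` (set_mset b \<times> set_mset b')" by (rule imageI)
      then show ?thesis using 2(2) by simp
    next
      case (3 a)
      then have "xs ! a \<in> set_mset b" using m by auto
      then show ?thesis using 3(2) by blast
    next
      case (4 i)
      then have "ys ! i \<in> set_mset b'" using m by auto
      then show ?thesis using 4(2) by blast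
    qed simp
  qed
qed

lemma matching_costs_nonempty: "matching_costs b b' \<noteq> {}"
proof -
  obtain xs ys where "mset xs = b" "mset ys = b'" using ex_mset[of b] ex_mset[of b'] by blast
  moreover have "partial_matching xs ys {} id" by (simp add: partial_matching_def)
  ultimately show ?thesis by blast
qed

lemma bottleneck_eq_Min: "bottleneck b b' = Min (matching_costs b b')"
  unfolding bottleneck_def
  by (rule cInf_eq_Min[OF finite_matching_costs matching_costs_nonempty])

lemma bottleneck_in: "bottleneck b b' \<in> matching_costs b b'"
  unfolding bottleneck_eq_Min by (rule Min_in[OF finite_matching_costs matching_costs_nonempty])

lemma bottleneck_nonneg: "0 \<le> bottleneck b b'"
  using bottleneck_in[of b b'] matching_cost_nonneg by force

lemma bottleneck_match:
  assumes "mset xs = b" "mset ys = b'"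
  shows "\<exists>R. match_le (bottleneck b b') xs ys R"
proof -
  obtain xs' ys' A \<theta> where 1: "mset xs' = b" "mset ys' = b'" "partial_matching xs' ys' A \<theta>"
    and 2: "bottleneck b b' = matching_cost xs' ys' A \<theta>"
    using bottleneck_in[of b b'] by blast
  obtain R where "match_le (bottleneck b b') xs' ys' R"
    using matching_cost_imp_match_le[OF 1(3)] 2 by auto
  moreover obtain P where "match_le 0 xs xs' P" using match_le_mset_eq[of xs xs'] assms 1 by auto
  moreover obtain Q where "match_le 0 ys' ys Q" using match_le_mset_eq[of ys' ys] assms 1 by auto
  ultimately have "match_le (0 + (bottleneck b b' + 0)) xs ys (P O (R O Q))"
    by (intro match_le_trans add_nonneg_nonneg) (auto simp: bottleneck_nonneg)
  then show ?thesis by auto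
qed

lemma bottleneck_le:
  assumes "match_le r xs ys R" "0 \<le> r" "mset xs = b" "mset ys = b'"
  shows "bottleneck b b' \<le> r"
proof -
  obtain A \<theta> where A: "partial_matching xs ys A \<theta>" "matching_cost xs ys A \<theta> \<le> r"
    using match_le_imp_matching_cost[OF assms(1,2)] by blast
  have "bottleneck b b' \<le> matching_cost xs ys A \<theta>"
    unfolding bottleneck_eq_Min
  proof (rule Min_le[OF finite_matching_costs])
    show "matching_cost xs ys A \<theta> \<in> matching_costs b b'"
      using A(1) assms(3,4) by blast
  qed
  then show ?thesis using A by linarith
qed

lemma bottleneck_commute: "bottleneck b b' = bottleneck b' b"
proof -
  have "bottleneck b b' \<le> bottleneck b' b" for b b'
  proof -
    obtain xs ys where *: "mset xs = b" "mset ys = b'" using ex_mset[of b] ex_mset[of b'] by blast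
    obtain R where "match_le (bottleneck b' b) ys xs R" using bottleneck_match[OF *(2,1)] by blast
    from bottleneck_le[OF match_le_sym[OF this] bottleneck_nonneg *] show ?thesis .
  qed
  then show ?thesis by (simp add: order_antisym)
qed

lemma bottleneck_triangle: "bottleneck b b'' \<le> bottleneck b b' + bottleneck b' b''"
proof -
  obtain xs where x: "mset xs = b" using ex_mset[of b] ..
  obtain ys where y: "mset ys = b'" using ex_mset[of b'] ..
  obtain zs where z: "mset zs = b''" using ex_mset[of b''] ..
  note * = x y z
  obtain R where R: "match_le (bottleneck b b') xs ys R" using bottleneck_match[OF *(1,2)] by blast
  obtain S where S: "match_le (bottleneck b' b'') ys zs S" using bottleneck_match[OF *(2,3)] by blast
  show ?thesis
    by (rule bottleneck_le[OF match_le_trans[OF R S bottleneck_nonneg bottleneck_nonneg]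
          add_nonneg_nonneg[OF bottleneck_nonneg bottleneck_nonneg] *(1) *(3)])
qed

lemma bottleneck_filter:
  "bottleneck (filter_mset (\<lambda>(x, d). d \<noteq> 0) b) b = 0"
proof -
  let ?P = "\<lambda>(x::real, d::real). d \<noteq> 0"
  obtain us vs where u: "mset us = filter_mset ?P b" and v: "mset vs = filter_mset (Not \<circ> ?P) b"
    using ex_mset[of "filter_mset ?P b"] ex_mset[of "filter_mset (Not \<circ> ?P) b"] by blast
  have uv: "mset (us @ vs) = b" using u v by (simp add: o_def)
  have z: "snd p = 0" if "p \<in> set vs" for p
  proof -
    have "p \<in># filter_mset (Not \<circ> ?P) b" using that v set_mset_mset by metis
    then show ?thesis by auto
  qed
  have "match_le 0 us (us @ vs) {(i, i) | i. i < length us}"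
    unfolding match_le_def
  proof (intro conjI allI impI)
    show "bar_dist (us ! a) ((us @ vs) ! b) \<le> 0" if "(a, b) \<in> {(i, i) | i. i < length us}" for a b
      using that by (cases "us ! a") (auto simp: nth_append)
    show "diag_dist ((us @ vs) ! b) \<le> 0"
      if b: "b < length (us @ vs)" "\<forall>a. (a, b) \<notin> {(i, i) | i. i < length us}" for b
    proof -
      have "\<not> b < length us" using b(2) by auto
      then have "(us @ vs) ! b \<in> set vs" using b(1) by (simp add: nth_append)
      from z[OF this] show ?thesis by (cases "(us @ vs) ! b") simp
    qed
  qed auto
  from bottleneck_le[OF this _ u uv] show ?thesis using bottleneck_nonneg by (simp add: order_antisym)
qed

lemma bottleneck_cong:
  assumes "bar_equiv b b'" "bar_equiv c c'"
  shows "bottleneck b c = bottleneck b' c'"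
proof -
  let ?f = "filter_mset (\<lambda>(x, d). d \<noteq> (0::real))"
  have "bottleneck b c = bottleneck (?f b) (?f c)" for b c :: "bar multiset"
    using bottleneck_triangle[of b c "?f b"] bottleneck_triangle[of "?f b" c "?f c"]
      bottleneck_triangle[of "?f b" "?f c" b] bottleneck_triangle[of b "?f c" c]
      bottleneck_filter[of b] bottleneck_filter[of c]
    by (simp add: bottleneck_commute)
  then show ?thesis using assms unfolding bar_equiv_def by metis
qed

lemma bottleneck_eq_0_imp:
  assumes 0: "bottleneck b b' = 0"
    and b: "\<forall>(x, d) \<in># b. 0 \<le> x \<and> 0 \<le> d" and b': "\<forall>(x, d) \<in># b'. 0 \<le> x \<and> 0 \<le> d"
  shows "bar_equiv b b'"
proof -
  obtain xs ys where *: "mset xs = b" "mset ys = b'" using ex_mset[of b] ex_mset[of b'] by blast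
  obtain R where R: "match_le 0 xs ys R" using bottleneck_match[OF *] 0 by auto
  let ?nz = "\<lambda>(x::real, d::real). d \<noteq> 0"
  have zero: "p = q" if "bar_dist p q \<le> 0" for p q
    using that by (cases p; cases q) (auto simp: max_def split: if_splits)
  have R1: "i < length xs" "j < length ys" if "(i, j) \<in> R" for i j
    using R that unfolding match_le_def by auto
  have R2: "j = j'" if "(i, j) \<in> R" "(i, j') \<in> R" for i j j'
    using R that unfolding match_le_def by simp
  have R3: "i = i'" if "(i, j) \<in> R" "(i', j) \<in> R" for i i' j
    using R that unfolding match_le_def by simp
  have R4: "bar_dist (xs ! i) (ys ! j) \<le> 0" if "(i, j) \<in> R" for i j
    using R that unfolding match_le_def by simp
  have R5: "diag_dist (xs ! i) \<le> 0" if "i < length xs" "\<And>j. (i, j) \<notin> R" for i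
    using R that unfolding match_le_def by simp
  have R6: "diag_dist (ys ! j) \<le> 0" if "j < length ys" "\<And>i. (i, j) \<notin> R" for j
    using R that unfolding match_le_def by simp
  have eq: "xs ! i = ys ! j" if "(i, j) \<in> R" for i j
    by (rule zero[OF R4[OF that]])
  have pos: "\<not> diag_dist p \<le> 0" if "p \<in># b + b'" "?nz p" for p
  proof (cases p)
    case (Pair x d)
    then have "0 \<le> d" using that(1) b b' by auto
    then show ?thesis using that(2) Pair by simp
  qed
  define I where "I = {i. i < length xs \<and> ?nz (xs ! i)}"
  define J where "J = {j. j < length ys \<and> ?nz (ys ! j)}"
  define f where "f i = (THE j. (i, j) \<in> R)" for i
  have f: "f i = j" if "(i, j) \<in> R" for i j
    unfolding f_def using that R2 by (intro the_equality) blast+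
  have RI: "(i, f i) \<in> R" if i: "i \<in> I" for i
  proof -
    have l: "i < length xs" and "?nz (xs ! i)" using i by (simp_all add: I_def)
    moreover have "xs ! i \<in># b + b'" using l *(1) by auto
    ultimately have "\<not> diag_dist (xs ! i) \<le> 0" by (intro pos)
    then obtain j where "(i, j) \<in> R" using R5[OF l] by blast
    then show ?thesis using f by simp
  qed
  have RJ: "\<exists>i. (i, j) \<in> R" if j: "j \<in> J" for j
  proof -
    have l: "j < length ys" and "?nz (ys ! j)" using j by (simp_all add: J_def)
    moreover have "ys ! j \<in># b + b'" using l *(2) by auto
    ultimately have "\<not> diag_dist (ys ! j) \<le> 0" by (intro pos)
    then show ?thesis using R6[OF l] by blast
  qed
  have inj: "inj_on f I"
  proof (rule inj_onI)
    fix i i' assume "i \<in> I" "i' \<in> I" "f i = f i'"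
    then have "(i, f i) \<in> R" "(i', f i) \<in> R" using RI[of i] RI[of i'] by simp_all
    then show "i = i'" by (rule R3)
  qed
  have img: "f ` I = J"
  proof
    show "f ` I \<subseteq> J"
    proof
      fix j assume "j \<in> f ` I"
      then obtain i where i: "i \<in> I" "j = f i" by blast
      have ij: "(i, j) \<in> R" using RI[OF i(1)] i(2) by simp
      show "j \<in> J" using i(1) eq[OF ij] R1(2)[OF ij] by (simp add: I_def J_def)
    qed
    show "J \<subseteq> f ` I"
    proof
      fix j assume j: "j \<in> J"
      then obtain i where i: "(i, j) \<in> R" using RJ by blast
      then have "i \<in> I" using j eq[OF i] R1(1)[OF i] by (simp add: I_def J_def)
      then show "j \<in> f ` I" using f[OF i] by blast
    qed
  qed
  have filt: "filter_mset ?nz (mset zs) = image_mset ((!) zs) (mset_set {i. i < length zs \<and> ?nz (zs ! i)})"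
    for zs :: "bar list"
  proof -
    have "mset zs = image_mset ((!) zs) (mset_set {..<length zs})"
      by (metis map_nth mset_map mset_upt atLeast0LessThan)
    then have "filter_mset ?nz (mset zs)
      = image_mset ((!) zs) (filter_mset (\<lambda>i. ?nz (zs ! i)) (mset_set {..<length zs}))"
      by (simp add: filter_mset_image_mset)
    also have "filter_mset (\<lambda>i. ?nz (zs ! i)) (mset_set {..<length zs})
      = mset_set {i. i < length zs \<and> ?nz (zs ! i)}"
      by (subst filter_mset_mset_set) (auto intro!: arg_cong[where f = mset_set])
    finally show ?thesis .
  qed
  have "image_mset ((!) xs) (mset_set I) = image_mset ((!) ys \<circ> f) (mset_set I)"
  proof (rule image_mset_cong)
    fix i assume "i \<in># mset_set I"
    then have "i \<in> I" by (simp add: I_def)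
    from eq[OF RI[OF this]] show "xs ! i = ((!) ys \<circ> f) i" by simp
  qed
  also have "\<dots> = image_mset ((!) ys) (mset_set J)"
    using image_mset_mset_set[OF inj] img by (metis multiset.map_comp)
  finally have "filter_mset ?nz b = filter_mset ?nz b'"
    using filt[of xs] filt[of ys] * unfolding I_def J_def by simp
  then show ?thesis unfolding bar_equiv_def using b b' by auto
qed

instantiation barcode :: metric_space
begin

lift_definition dist_barcode :: "barcode \<Rightarrow> barcode \<Rightarrow> real" is bottleneck
  by (rule bottleneck_cong)

definition uniformity_barcode :: "(barcode \<times> barcode) filter" where
  "uniformity_barcode = (INF e\<in>{0 <..}. principal {(x, y). dist x y < e})"

definition open_barcode :: "barcode set \<Rightarrow> bool" where
  "open_barcode S \<longleftrightarrow> (\<forall>x\<in>S. \<forall>\<^sub>F (x', y) in uniformity. x' = x \<longrightarrow> y \<in> S)"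

instance
proof
  fix x y z :: barcode
  show "dist x y = 0 \<longleftrightarrow> x = y"
  proof transfer
    fix b b' assume bb: "bar_equiv b b" "bar_equiv b' b'"
    then have nn: "\<forall>(x, d) \<in># b. 0 \<le> x \<and> 0 \<le> d" "\<forall>(x, d) \<in># b'. 0 \<le> x \<and> 0 \<le> d"
      by (auto simp: bar_equiv_def)
    have self: "bottleneck b b = 0"
      using bottleneck_triangle[of b b "filter_mset (\<lambda>(x, d). d \<noteq> 0) b"] bottleneck_filter[of b]
        bottleneck_nonneg[of b b] by (simp add: bottleneck_commute)
    show "(bottleneck b b' = 0) = bar_equiv b b'"
    proof
      assume "bar_equiv b b'"
      from bottleneck_cong[OF bb(1) this] self show "bottleneck b b' = 0" by simp
    qed (rule bottleneck_eq_0_imp[OF _ nn])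
  qed
  show "dist x y \<le> dist x z + dist y z"
    by transfer (metis bottleneck_triangle bottleneck_commute)
qed (simp_all add: uniformity_barcode_def open_barcode_def)

end

section \<open>Completion of a metric space\<close>

text \<open>The completion is the closure of the image of the Kuratowski embedding into the Banach space
  of bounded continuous functions. It is characterised, up to isometry, by being a complete space
  with an isometric map \<open>to_completed\<close> of dense range.\<close>

definition kuratowski :: "'a::metric_space \<Rightarrow> ('a \<Rightarrow>\<^sub>C real)" where
  "kuratowski x = Bcontfun (\<lambda>y. dist x y - dist undefined y)"

lemma apply_kuratowski: "apply_bcontfun (kuratowski x) y = dist x y - dist undefined y"
proof -
  have "\<bar>dist x y - dist undefined y\<bar> \<le> dist x undefined" for y
    using dist_triangle[of x y undefined] dist_triangle[of undefined y x]
    by (simp add: dist_commute abs_le_iff)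
  then have "bounded (range (\<lambda>y. dist x y - dist undefined y))"
    unfolding bounded_iff by (intro exI[of _ "dist x undefined"]) auto
  then have "(\<lambda>y. dist x y - dist undefined y) \<in> bcontfun"
    by (simp add: bcontfun_def continuous_intros)
  then show ?thesis by (simp add: kuratowski_def Bcontfun_inverse)
qed

lemma dist_kuratowski: "dist (kuratowski x) (kuratowski y) = dist x y"
proof (rule antisym)
  show "dist (kuratowski x) (kuratowski y) \<le> dist x y"
  proof (rule dist_bound)
    fix z
    show "dist (apply_bcontfun (kuratowski x) z) (apply_bcontfun (kuratowski y) z) \<le> dist x y"
      using dist_triangle[of x z y] dist_triangle[of y z x]
      by (simp add: apply_kuratowski dist_real_def dist_commute abs_le_iff)
  qed
  have "dist x y = dist (apply_bcontfun (kuratowski x) y) (apply_bcontfun (kuratowski y) y)"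
    by (simp add: apply_kuratowski dist_real_def)
  also have "\<dots> \<le> dist (kuratowski x) (kuratowski y)" by (rule dist_bounded)
  finally show "dist x y \<le> dist (kuratowski x) (kuratowski y)" .
qed

typedef (overloaded) ('a::metric_space) completed = "closure (range (kuratowski :: 'a \<Rightarrow> _))"
  by (meson closure_subset rangeI subsetD)

instantiation completed :: (metric_space) metric_space
begin

definition dist_completed :: "'a completed \<Rightarrow> 'a completed \<Rightarrow> real" where
  "dist_completed x y = dist (Rep_completed x) (Rep_completed y)"

definition uniformity_completed :: "('a completed \<times> 'a completed) filter" where
  "uniformity_completed = (INF e\<in>{0 <..}. principal {(x, y). dist x y < e})"

definition open_completed :: "'a completed set \<Rightarrow> bool" where
  "open_completed S \<longleftrightarrow> (\<forall>x\<in>S. \<forall>\<^sub>F (x', y) in uniformity. x' = x \<longrightarrow> y \<in> S)"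

instance
  by standard
    (auto simp: dist_completed_def uniformity_completed_def open_completed_def
      Rep_completed_inject dist_triangle2)

end

instance completed :: (metric_space) complete_space
proof
  fix X :: "nat \<Rightarrow> 'a completed"
  assume "Cauchy X"
  then have "Cauchy (\<lambda>n. Rep_completed (X n))" by (simp add: Cauchy_def dist_completed_def)
  then obtain l where l: "(\<lambda>n. Rep_completed (X n)) \<longlonglongrightarrow> l"
    using Cauchy_convergent convergent_def by blast
  then have "l \<in> closure (range kuratowski)"
    by (rule closed_sequentially[OF closed_closure, rotated]) (rule Rep_completed)
  then have "Rep_completed (Abs_completed l) = l" by (rule Abs_completed_inverse)
  then have "X \<longlonglongrightarrow> Abs_completed l"
    using l by (simp add: tendsto_iff dist_completed_def)
  then show "convergent X" by (auto simp: convergent_def)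
qed

definition to_completed :: "'a::metric_space \<Rightarrow> 'a completed" where
  "to_completed x = Abs_completed (kuratowski x)"

lemma dist_to_completed: "dist (to_completed x) (to_completed y) = dist x y"
proof -
  have "kuratowski z \<in> closure (range kuratowski)" for z :: 'a
    by (meson closure_subset rangeI subsetD)
  then show ?thesis
    by (simp add: to_completed_def dist_completed_def Abs_completed_inverse dist_kuratowski)
qed

lemma closure_range_to_completed: "closure (range to_completed) = UNIV"
proof -
  have "\<exists>y. dist (to_completed y) x < e" if e: "e > 0" for x :: "'a completed" and e :: real
  proof -
    obtain y where "dist (kuratowski y) (Rep_completed x) < e"
      using Rep_completed[of x] e unfolding closure_approachable by blast
    moreover have "kuratowski y \<in> closure (range kuratowski)"
      by (meson closure_subset rangeI subsetD)
    ultimately show ?thesis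
      by (metis Abs_completed_inverse dist_completed_def to_completed_def)
  qed
  then show ?thesis by (auto simp: closure_approachable)
qed

section \<open>The space of nonempty compact subsets\<close>

definition thickening :: "real \<Rightarrow> 'a::metric_space set \<Rightarrow> 'a set" where
  "thickening t A = {x. infdist x A \<le> t}"

definition hausdorff_dist :: "'a::metric_space set \<Rightarrow> 'a set \<Rightarrow> real" where
  "hausdorff_dist A B = max (Inf {t. 0 \<le> t \<and> A \<subseteq> thickening t B}) (Inf {t. 0 \<le> t \<and> B \<subseteq> thickening t A})"

lemma excess_le_iff:
  fixes A B :: "'a::metric_space set"
  assumes A: "compact A" and B: "B \<noteq> {}" and r: "0 \<le> r"
  shows "Inf {t. 0 \<le> t \<and> A \<subseteq> thickening t B} \<le> r \<longleftrightarrow> A \<subseteq> thickening r B"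
proof
  let ?S = "{t. 0 \<le> t \<and> A \<subseteq> thickening t B}"
  have bdd: "bdd_below ?S" by (rule bdd_belowI[of _ 0]) auto
  show "Inf ?S \<le> r" if "A \<subseteq> thickening r B" using that r by (intro cInf_lower bdd) auto
  obtain b where b: "b \<in> B" using B by blast
  have "bounded A" using A compact_imp_bounded by blast
  then obtain e where e: "\<forall>a\<in>A. dist b a \<le> e" unfolding bounded_any_center[where a = b] by blast
  have "max e 0 \<in> ?S"
    using e infdist_le[OF b] by (auto simp: thickening_def) (metis dist_commute max.coboundedI1 order_trans)
  then have ne: "?S \<noteq> {}" by blast
  show "A \<subseteq> thickening r B" if le: "Inf ?S \<le> r"
  proof
    fix a assume a: "a \<in> A"
    have "infdist a B \<le> t" if "t \<in> ?S" for t using that a by (auto simp: thickening_def)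
    then have "infdist a B \<le> Inf ?S" using ne by (intro cInf_greatest) auto
    then show "a \<in> thickening r B" using le by (simp add: thickening_def)
  qed
qed

lemma hausdorff_dist_nonneg:
  assumes "compact A" "compact B" "A \<noteq> {}" "B \<noteq> {}"
  shows "0 \<le> hausdorff_dist A B"
proof (rule ccontr)
  assume "\<not> ?thesis"
  then have neg: "Inf {t. 0 \<le> t \<and> A \<subseteq> thickening t B} < 0" by (simp add: hausdorff_dist_def)
  then have "A \<subseteq> thickening 0 B" using excess_le_iff[of A B 0] assms by simp
  then have "0 \<in> {t. 0 \<le> t \<and> A \<subseteq> thickening t B}" by simp
  then have "0 \<le> Inf {t. 0 \<le> t \<and> A \<subseteq> thickening t B}" by (intro cInf_greatest) auto
  then show False using neg by simp
qed

lemma hausdorff_dist_le_iff: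
  assumes "compact A" "compact B" "A \<noteq> {}" "B \<noteq> {}" "0 \<le> r"
  shows "hausdorff_dist A B \<le> r \<longleftrightarrow> (\<forall>a\<in>A. infdist a B \<le> r) \<and> (\<forall>b\<in>B. infdist b A \<le> r)"
  using excess_le_iff[OF assms(1,4,5)] excess_le_iff[OF assms(2,3,5)]
  unfolding hausdorff_dist_def by (auto simp: thickening_def)

typedef (overloaded) ('a::metric_space) compacts = "{K :: 'a set. compact K \<and> K \<noteq> {}}"
  by (rule exI[of _ "{undefined}"]) simp

lemma Rep_compacts_simps: "compact (Rep_compacts K)" "Rep_compacts K \<noteq> {}"
  using Rep_compacts[of K] by auto

instantiation compacts :: (metric_space) metric_space
begin

definition dist_compacts :: "'a compacts \<Rightarrow> 'a compacts \<Rightarrow> real" where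
  "dist_compacts A B = hausdorff_dist (Rep_compacts A) (Rep_compacts B)"

definition uniformity_compacts :: "('a compacts \<times> 'a compacts) filter" where
  "uniformity_compacts = (INF e\<in>{0 <..}. principal {(x, y). dist x y < e})"

definition open_compacts :: "'a compacts set \<Rightarrow> bool" where
  "open_compacts S \<longleftrightarrow> (\<forall>x\<in>S. \<forall>\<^sub>F (x', y) in uniformity. x' = x \<longrightarrow> y \<in> S)"

instance
proof
  fix A B C :: "'a compacts"
  note le_iff = hausdorff_dist_le_iff[OF Rep_compacts_simps(1) Rep_compacts_simps(1)
      Rep_compacts_simps(2) Rep_compacts_simps(2)]
  note nn = hausdorff_dist_nonneg[OF Rep_compacts_simps(1) Rep_compacts_simps(1)
      Rep_compacts_simps(2) Rep_compacts_simps(2)]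
  have sub: "A \<subseteq> B" if "\<forall>a\<in>A. infdist a B \<le> 0" "compact B" "B \<noteq> {}" for A B :: "'a set"
  proof
    fix a assume "a \<in> A"
    then have "infdist a B = 0" using that(1) infdist_nonneg by (metis order_antisym)
    then show "a \<in> B" using in_closed_iff_infdist_zero[OF compact_imp_closed] that by blast
  qed
  show "dist A B = 0 \<longleftrightarrow> A = B"
  proof
    assume "dist A B = 0"
    then have "hausdorff_dist (Rep_compacts A) (Rep_compacts B) \<le> 0" by (simp add: dist_compacts_def)
    then have "\<forall>a\<in>Rep_compacts A. infdist a (Rep_compacts B) \<le> 0"
      "\<forall>b\<in>Rep_compacts B. infdist b (Rep_compacts A) \<le> 0"
      unfolding le_iff[OF order_refl] by blast+
    then have "Rep_compacts A = Rep_compacts B" by (intro equalityI sub Rep_compacts_simps)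
    then show "A = B" by (simp add: Rep_compacts_inject)
  next
    assume "A = B"
    then have "hausdorff_dist (Rep_compacts A) (Rep_compacts B) \<le> 0"
      unfolding le_iff[OF order_refl] by simp
    then show "dist A B = 0" using nn[of A B] by (simp add: dist_compacts_def)
  qed
  have comm: "hausdorff_dist K L = hausdorff_dist L K" for K L :: "'a set"
    by (simp add: hausdorff_dist_def max.commute)
  let ?r = "dist A C + dist B C"
  have ex: "infdist a L \<le> r + s"
    if K: "infdist a K \<le> r" and L: "\<forall>x\<in>K. infdist x L \<le> s" and c: "compact K" "K \<noteq> {}"
    for a :: 'a and K L :: "'a set" and r s
  proof -
    obtain x where x: "x \<in> K" "\<And>y. y \<in> K \<Longrightarrow> dist a x \<le> dist a y"
      using continuous_attains_inf[OF c continuous_on_dist[OF continuous_on_const continuous_on_id]]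
      by blast
    have "dist a x \<le> infdist a K"
      unfolding infdist_notempty[OF c(2)] by (rule cINF_greatest[OF c(2) x(2)])
    moreover have "infdist x L \<le> s" using L x(1) by blast
    ultimately show ?thesis using infdist_triangle[of a L x] K by linarith
  qed
  have AC: "\<forall>a\<in>Rep_compacts A. infdist a (Rep_compacts C) \<le> dist A C"
    "\<forall>a\<in>Rep_compacts C. infdist a (Rep_compacts A) \<le> dist A C"
    using le_iff[OF nn[of A C], of A C] by (simp_all add: dist_compacts_def)
  have BC: "\<forall>a\<in>Rep_compacts B. infdist a (Rep_compacts C) \<le> dist B C"
    "\<forall>a\<in>Rep_compacts C. infdist a (Rep_compacts B) \<le> dist B C"
    using le_iff[OF nn[of B C], of B C] by (simp_all add: dist_compacts_def)
  have "0 \<le> ?r" using nn[of A C] nn[of B C] by (simp add: dist_compacts_def)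
  moreover have "\<forall>a\<in>Rep_compacts A. infdist a (Rep_compacts B) \<le> ?r"
    using ex[OF bspec[OF AC(1)] BC(2) Rep_compacts_simps] by simp
  moreover have "\<forall>b\<in>Rep_compacts B. infdist b (Rep_compacts A) \<le> ?r"
    using ex[OF bspec[OF BC(1)] AC(2) Rep_compacts_simps] by (simp add: add.commute)
  ultimately show "dist A B \<le> ?r"
    unfolding dist_compacts_def[of A B] by (simp add: le_iff)
qed (simp_all add: uniformity_compacts_def open_compacts_def)

end

section \<open>Simplicial homology with field coefficients\<close>

text \<open>An abstract simplicial complex is a family of nonempty finite vertex sets closed under nonempty
  subsets. An oriented \<open>j\<close>-chain is a function on oriented simplices, i.e. on vertex lists
  \<open>[x\<^sub>0, \<dots>, x\<^sub>j]\<close> without repetition, that changes by the sign of the permutation when the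
  vertices are permuted. Only finite complexes are used below.\<close>

definition chains :: "'a set set \<Rightarrow> nat \<Rightarrow> ('a list \<Rightarrow> 'k::field) set" where
  "chains K j = {c.
     (\<forall>xs. c xs \<noteq> 0 \<longrightarrow> length xs = Suc j \<and> distinct xs \<and> set xs \<in> K) \<and>
     (\<forall>xs p. p permutes {..<length xs} \<longrightarrow> c (permute_list p xs) = of_int (sign p) * c xs)}"

text \<open>The oriented simplex \<open>[y\<^sub>0, \<dots>, y\<^sub>j]\<close> occurs in the boundary of \<open>[v, y\<^sub>0, \<dots>, y\<^sub>j]\<close> with
  coefficient 1, and every oriented coface with \<open>[y\<^sub>0, \<dots>, y\<^sub>j]\<close> in its boundary can be
  reordered to have this form.\<close>

definition boundary :: "('a list \<Rightarrow> 'k::field) \<Rightarrow> ('a list \<Rightarrow> 'k)" where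
  "boundary c = (\<lambda>ys. \<Sum>v | c (v # ys) \<noteq> 0. c (v # ys))"

text \<open>The boundary of every 0-chain is 0, as there are no chains in degree \<open>-1\<close>.\<close>

definition cycles :: "'a set set \<Rightarrow> nat \<Rightarrow> ('a list \<Rightarrow> 'k::field) set" where
  "cycles K j = {c \<in> chains K j. 0 < j \<longrightarrow> boundary c = 0}"

definition boundaries :: "'a set set \<Rightarrow> nat \<Rightarrow> ('a list \<Rightarrow> 'k::field) set" where
  "boundaries K j = boundary ` chains K (Suc j)"

definition homology :: "'a set set \<Rightarrow> nat \<Rightarrow> ('a list \<Rightarrow> 'k::field) set set" where
  "homology K j = (\<lambda>z. z +o boundaries K j) ` cycles K j"

text \<open>The chain map of a simplicial map \<open>f\<close> sends \<open>[x\<^sub>0, \<dots>, x\<^sub>j]\<close> to \<open>[f x\<^sub>0, \<dots>, f x\<^sub>j]\<close>, or to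
  0 if two of these vertices coincide.\<close>

definition chain_map :: "('a \<Rightarrow> 'b) \<Rightarrow> ('a list \<Rightarrow> 'k::field) \<Rightarrow> ('b list \<Rightarrow> 'k)" where
  "chain_map f c = (\<lambda>ys. if distinct ys then \<Sum>xs | c xs \<noteq> 0 \<and> map f xs = ys. c xs else 0)"

text \<open>The induced map into the degree-\<open>j\<close> homology of the complex \<open>L\<close>: the class of \<open>z\<close> is sent
  to the class of \<open>chain_map f z\<close>.\<close>

definition hom_induced ::
  "'b set set \<Rightarrow> nat \<Rightarrow> ('a \<Rightarrow> 'b) \<Rightarrow> ('a list \<Rightarrow> 'k::field) set \<Rightarrow> ('b list \<Rightarrow> 'k) set" where
  "hom_induced L j f h = chain_map f ` h + boundaries L j"

abbreviation point_complex :: "unit set set" where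
  "point_complex \<equiv> {{()}}"

definition reduced_homology :: "'a set set \<Rightarrow> nat \<Rightarrow> ('a list \<Rightarrow> 'k::field) set set" where
  "reduced_homology K j =
     {h \<in> homology K j. hom_induced point_complex j (\<lambda>_. ()) h = boundaries point_complex j}"

section \<open>Persistence modules and their barcodes\<close>

text \<open>Persistence modules indexed by \<open>[0, \<infinity>)\<close>: the vector space at time \<open>t\<close> with its
  operations, and the transition map from time \<open>s\<close> to time \<open>t\<close>. Only times \<open>0 \<le> s \<le> t\<close> matter.\<close>

record ('k, 'v) pers_module =
  pcarrier :: "real \<Rightarrow> 'v set"
  padd :: "real \<Rightarrow> 'v \<Rightarrow> 'v \<Rightarrow> 'v"
  psmult :: "real \<Rightarrow> 'k \<Rightarrow> 'v \<Rightarrow> 'v"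
  ptrans :: "real \<Rightarrow> real \<Rightarrow> 'v \<Rightarrow> 'v"

definition pers_iso :: "('k, 'v) pers_module \<Rightarrow> ('k, 'w) pers_module \<Rightarrow> bool" where
  "pers_iso M N \<longleftrightarrow> (\<exists>f. \<forall>t\<ge>0.
     bij_betw (f t) (pcarrier M t) (pcarrier N t) \<and>
     (\<forall>x\<in>pcarrier M t. \<forall>y\<in>pcarrier M t. f t (padd M t x y) = padd N t (f t x) (f t y)) \<and>
     (\<forall>a. \<forall>x\<in>pcarrier M t. f t (psmult M t a x) = psmult N t a (f t x)) \<and>
     (\<forall>s\<in>{0..t}. \<forall>x\<in>pcarrier M s. f t (ptrans M s t x) = ptrans N s t (f s x)))"

definition interval_module :: "real set \<Rightarrow> ('k::field, 'k) pers_module" where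
  "interval_module I =
     \<lparr> pcarrier = (\<lambda>t. if t \<in> I then UNIV else {0}),
       padd = (\<lambda>t. (+)),
       psmult = (\<lambda>t. (*)),
       ptrans = (\<lambda>s t x. if s \<in> I \<and> t \<in> I then x else 0) \<rparr>"

definition direct_sum :: "('k, 'v) pers_module list \<Rightarrow> ('k, nat \<Rightarrow> 'v) pers_module" where
  "direct_sum Ms =
     \<lparr> pcarrier = (\<lambda>t. \<Pi>\<^sub>E i\<in>{..<length Ms}. pcarrier (Ms ! i) t),
       padd = (\<lambda>t x y. \<lambda>i\<in>{..<length Ms}. padd (Ms ! i) t (x i) (y i)),
       psmult = (\<lambda>t a x. \<lambda>i\<in>{..<length Ms}. psmult (Ms ! i) t a (x i)),
       ptrans = (\<lambda>s t x. \<lambda>i\<in>{..<length Ms}. ptrans (Ms ! i) s t (x i)) \<rparr>"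

definition is_interval_decomposition ::
  "('k::field, 'v) pers_module \<Rightarrow> real set list \<Rightarrow> bool" where
  "is_interval_decomposition M Is \<longleftrightarrow>
     (\<forall>I\<in>set Is. I \<noteq> {} \<and> I \<subseteq> {0..} \<and> is_interval I \<and> bounded I) \<and>
     pers_iso (direct_sum (map interval_module Is)) M"

definition cech_complex :: "real \<Rightarrow> 'm::metric_space set \<Rightarrow> 'm set set" where
  "cech_complex t P = {\<sigma>. \<sigma> \<subseteq> P \<and> \<sigma> \<noteq> {} \<and> (\<Inter>x\<in>\<sigma>. cball x t) \<noteq> {}}"

text \<open>Sums and multiples of cosets of the boundaries; \<open>(\<lambda>xs. a * z xs)\<close> is the chain \<open>a z\<close>.\<close>

definition PH :: "nat \<Rightarrow> 'm::metric_space set \<Rightarrow> ('k::field, ('m list \<Rightarrow> 'k) set) pers_module" where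
  "PH k P =
     \<lparr> pcarrier = (\<lambda>t. reduced_homology (cech_complex t P) k),
       padd = (\<lambda>t. (+)),
       psmult = (\<lambda>t a h. (\<lambda>z xs. a * z xs) ` h + boundaries (cech_complex t P) k),
       ptrans = (\<lambda>s t. hom_induced (cech_complex t P) k id) \<rparr>"

definition interval_bar :: "real set \<Rightarrow> bar" where
  "interval_bar I = (Inf I, Sup I - Inf I)"

text \<open>The barcode of a finite set, with coefficients in the field \<open>'k\<close>. The multiset of intervals
  in an interval decomposition is unique.\<close>

definition finite_barcode :: "'k::field itself \<Rightarrow> nat \<Rightarrow> 'm::metric_space set \<Rightarrow> barcode" where
  "finite_barcode K k P = (THE b. \<exists>Is.
     is_interval_decomposition (PH k P :: ('k, ('m list \<Rightarrow> 'k) set) pers_module) Is \<and>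
     b = abs_barcode (mset (map interval_bar Is)))"

definition is_barcode_extension ::
  "'k::field itself \<Rightarrow> nat \<Rightarrow> ('m::metric_space compacts \<Rightarrow> barcode completed) \<Rightarrow> bool" where
  "is_barcode_extension K k f \<longleftrightarrow> continuous_on UNIV f \<and>
     (\<forall>P. finite P \<and> P \<noteq> {} \<longrightarrow> f (Abs_compacts P) = to_completed (finite_barcode K k P))"

lemma finite_compacts_dense:
  fixes A :: "'a::metric_space compacts"
  assumes "0 < e"
  shows "\<exists>P. finite P \<and> P \<noteq> {} \<and> dist (Abs_compacts P) A < e"
proof -
  have c: "compact (Rep_compacts A)" "Rep_compacts A \<noteq> {}" by (rule Rep_compacts_simps)+
  obtain P where P: "finite P" "P \<subseteq> Rep_compacts A" "Rep_compacts A \<subseteq> (\<Union>x\<in>P. ball x (e / 2))"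
    using compactE_image[OF c(1), of "Rep_compacts A" "\<lambda>x. ball x (e / 2)"] assms by force
  have ne: "P \<noteq> {}" using P(3) c(2) by auto
  have cP: "compact P" using P(1) by (rule finite_imp_compact)
  have rep: "Rep_compacts (Abs_compacts P) = P" using ne cP by (simp add: Abs_compacts_inverse)
  have "hausdorff_dist P (Rep_compacts A) \<le> e / 2"
  proof (subst hausdorff_dist_le_iff[OF cP c(1) ne c(2)])
    show "(\<forall>a\<in>P. infdist a (Rep_compacts A) \<le> e / 2) \<and> (\<forall>b\<in>Rep_compacts A. infdist b P \<le> e / 2)"
    proof (intro conjI ballI)
      show "infdist a (Rep_compacts A) \<le> e / 2" if "a \<in> P" for a
        using that P(2) assms by (simp add: subsetD)
      show "infdist b P \<le> e / 2" if "b \<in> Rep_compacts A" for b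
      proof -
        obtain x where "x \<in> P" "dist x b < e / 2" using P(3) \<open>b \<in> Rep_compacts A\<close> by auto
        then show ?thesis using infdist_le[of x P b] by (simp add: dist_commute)
      qed
    qed
  qed (use assms in simp)
  then show ?thesis using P(1) ne assms rep by (intro exI[of _ P]) (simp add: dist_compacts_def)
qed

lemma is_barcode_extension_unique:
  fixes f g :: "'m::metric_space compacts \<Rightarrow> barcode completed"
  assumes f: "is_barcode_extension TYPE('k::field) k f" and g: "is_barcode_extension TYPE('k) k g"
  shows "f = g"
proof
  fix A :: "'m compacts"
  define S where "S = {Abs_compacts P :: 'm compacts | P. finite P \<and> P \<noteq> {}}"
  have "A \<in> closure S"
    using finite_compacts_dense[of _ A] unfolding S_def closure_approachable by blast
  moreover have "f x = g x" if x: "x \<in> S" for x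
  proof -
    obtain P where "x = Abs_compacts P" "finite P" "P \<noteq> {}" using x unfolding S_def by blast
    then show ?thesis using f g unfolding is_barcode_extension_def by metis
  qed
  moreover have "closed {x. f x = g x}"
    using f g unfolding is_barcode_extension_def by (intro closed_Collect_eq) auto
  ultimately show "f A = g A" using closure_minimal[of S "{x. f x = g x}"] by blast
qed

text \<open>The unique continuous extension of the barcode map to compact sets. It exists because the
  barcode map is 1-Lipschitz on finite sets; that fact is not proved here, and the \<open>else\<close> branch
  serves only to make the definition total.\<close>

definition compact_barcode ::
  "'k::field itself \<Rightarrow> nat \<Rightarrow> 'm::metric_space compacts \<Rightarrow> barcode completed" where
  "compact_barcode K k =
     (if \<exists>f :: 'm compacts \<Rightarrow> barcode completed. is_barcode_extension K k f
      then THE f. is_barcode_extension K k f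
      else (\<lambda>_. to_completed (abs_barcode {#})))"

section \<open>Probability\<close>

definition msupport :: "'m::metric_space measure \<Rightarrow> 'm set" where
  "msupport \<mu> = {x. \<forall>\<epsilon>>0. emeasure \<mu> (ball x \<epsilon>) > 0}"

text \<open>As usual for random variables in a metric space that need not be separable, values are required
  to lie almost surely in a separable subset. The second condition is automatic for separable \<open>'m\<close>.
  Without it, that a Borel probability measure with compact support is concentrated on its support
  is not provable (real-valued measurable cardinals yield counterexamples).\<close>

definition random_element :: "'w measure \<Rightarrow> ('w \<Rightarrow> 'm::metric_space) \<Rightarrow> bool" where
  "random_element \<Omega> X \<longleftrightarrow>
     X \<in> borel_measurable \<Omega> \<and> (\<exists>D. countable D \<and> (AE \<omega> in \<Omega>. X \<omega> \<in> closure D))"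

text \<open>Random vectors are considered up to null sets, so the scalar expectations are taken with
  respect to the completed measure; for measurable integrands this changes nothing.\<close>

definition has_pettis_integral :: "'w measure \<Rightarrow> ('w \<Rightarrow> 'v::banach) \<Rightarrow> 'v \<Rightarrow> bool" where
  "has_pettis_integral \<Omega> \<xi> v \<longleftrightarrow> (\<forall>\<phi> :: 'v \<Rightarrow> real. bounded_linear \<phi> \<longrightarrow>
     has_bochner_integral (completion \<Omega>) (\<lambda>\<omega>. \<phi> (\<xi> \<omega>)) (\<phi> v))"

definition pettis_integrable :: "'w measure \<Rightarrow> ('w \<Rightarrow> 'v::banach) \<Rightarrow> bool" where
  "pettis_integrable \<Omega> \<xi> \<longleftrightarrow> (\<exists>v. has_pettis_integral \<Omega> \<xi> v)"

definition pettis_integral :: "'w measure \<Rightarrow> ('w \<Rightarrow> 'v::banach) \<Rightarrow> 'v" where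
  "pettis_integral \<Omega> \<xi> = (THE v. has_pettis_integral \<Omega> \<xi> v)"

definition rademacher_sequence :: "'w measure \<Rightarrow> (nat \<Rightarrow> 'w \<Rightarrow> real) \<Rightarrow> bool" where
  "rademacher_sequence \<Omega> \<epsilon> \<longleftrightarrow> prob_space \<Omega> \<and>
     prob_space.indep_vars \<Omega> (\<lambda>_. borel) \<epsilon> UNIV \<and>
     (\<forall>i. (\<forall>\<omega>\<in>space \<Omega>. \<epsilon> i \<omega> = 1 \<or> \<epsilon> i \<omega> = -1) \<and>
          measure \<Omega> {\<omega>\<in>space \<Omega>. \<epsilon> i \<omega> = 1} = 1 / 2 \<and>
          measure \<Omega> {\<omega>\<in>space \<Omega>. \<epsilon> i \<omega> = -1} = 1 / 2)"

text \<open>Definitions cannot quantify over types, so the sample space is a measure on \<open>nat \<Rightarrow> bool\<close>. This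
  type carries a Rademacher sequence (independent fair coin tosses), and the inequality depends only
  on the joint distribution of the signs, which is the same for all Rademacher sequences.\<close>

definition banach_type_2 :: "'v::banach itself \<Rightarrow> bool" where
  "banach_type_2 V \<longleftrightarrow>
     (\<forall>(\<Omega> :: (nat \<Rightarrow> bool) measure) \<epsilon>. rademacher_sequence \<Omega> \<epsilon> \<longrightarrow>
        (\<exists>C. \<forall>n. \<forall>x :: nat \<Rightarrow> 'v.
           sqrt (\<integral>\<omega>. (norm (\<Sum>i<n. \<epsilon> i \<omega> *\<^sub>R x i))\<^sup>2 \<partial>\<Omega>) \<le> C * sqrt (\<Sum>i<n. (norm (x i))\<^sup>2)))"

text \<open>\<open>P\<^sub>n\<close> for the sequence \<open>X 0, X 1, \<dots>\<close>; it is nonempty, hence in \<open>'m compacts\<close>, for \<open>n \<ge> 1\<close>.\<close>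

definition sample :: "(nat \<Rightarrow> 'w \<Rightarrow> 'm::metric_space) \<Rightarrow> nat \<Rightarrow> 'w \<Rightarrow> 'm compacts" where
  "sample X n \<omega> = Abs_compacts ((\<lambda>i. X i \<omega>) ` {..<n})"

end

theory Submission
  imports Defs
begin

text \<open>The expectation of \<open>F (sample X n \<omega>)\<close> tends to \<open>F C\<close> for every continuous map \<open>F\<close> from the
  nonempty compact subsets of the metric space, with the Hausdorff distance, to a Banach space
  (\<open>pettis_integral_sample_tendsto\<close>). The composition of \<open>T\<close> with the barcode map is such an \<open>F\<close>, as the
  barcode map on compact sets is continuous (\<open>continuous_compact_barcode\<close>).

  For general \<open>F\<close> the reason is that the sample fills out the support. Almost surely all \<open>X i\<close> lie in
  the support \<open>C\<close> (\<open>AE_in_msupport\<close>). For any finite net of \<open>C\<close>, the probability that the first \<open>n\<close>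
  points miss one of the balls around the net points decays geometrically (\<open>prob_miss_tendsto_0\<close>),
  and outside this event the sample is close to \<open>C\<close> in the Hausdorff distance. The compact subsets of
  \<open>C\<close> form a compact space (\<open>compact_hyperspace\<close>), so \<open>F\<close> is bounded there by some \<open>B\<close>, and the
  exceptional event contributes at most \<open>2 * B\<close> times its probability.

  Two facts about Pettis integrals make this precise. The norm of a Pettis integral is at most the
  integral of any function that dominates the norm of the integrand
  (\<open>has_pettis_integral_norm_le\<close>); this rests on the existence of norming functionals, a form of
  the Hahn--Banach theorem. And a uniform limit of integrable functions is integrable
  (\<open>has_pettis_integral_uniform_limit\<close>), which applies to \<open>F (sample X n \<omega>)\<close> because rounding the
  sample points to finite nets of \<open>C\<close> yields simple functions.\<close>

section \<open>Norming functionals\<close>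

text \<open>Homogeneity is required as an inequality only, so that it passes to infima;
  the reverse inequality follows by rescaling with \<open>inverse a\<close>.\<close>

definition sublinear :: "('a::real_vector \<Rightarrow> real) \<Rightarrow> bool" where
  "sublinear p \<longleftrightarrow> (\<forall>x y. p (x + y) \<le> p x + p y) \<and> (\<forall>a\<ge>0. \<forall>x. p (a *\<^sub>R x) \<le> a * p x)"

lemma sublinear_zero:
  assumes "sublinear p" shows "p 0 = 0"
proof (rule antisym)
  show "p 0 \<le> 0" using assms unfolding sublinear_def by (metis mult_zero_left order_refl scaleR_zero_left)
  have "p (0 + 0) \<le> p 0 + p 0" using assms unfolding sublinear_def by blast
  then show "0 \<le> p 0" by simp
qed

lemma sublinear_add: "sublinear p \<Longrightarrow> p (x + y) \<le> p x + p y"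
  by (simp add: sublinear_def)

lemma sublinear_scaleR:
  assumes p: "sublinear p" and a: "0 \<le> a"
  shows "p (a *\<^sub>R x) = a * p x"
proof (cases "a = 0")
  case True
  then show ?thesis using sublinear_zero[OF p] by simp
next
  case False
  have "p (inverse a *\<^sub>R (a *\<^sub>R x)) \<le> inverse a * p (a *\<^sub>R x)"
    using p a unfolding sublinear_def by (metis inverse_nonnegative_iff_nonnegative)
  then have "a * p x \<le> p (a *\<^sub>R x)" using False a by (simp add: field_simps)
  then show ?thesis using p a unfolding sublinear_def by (simp add: antisym)
qed

lemma sublinear_minus: "sublinear p \<Longrightarrow> - p (- x) \<le> p x"
  using sublinear_add[of p x "- x"] sublinear_zero[of p] by simp

text \<open>For sublinear \<open>p\<close>, \<open>tilt p y\<close> is the largest sublinear functional below \<open>p\<close> whose value at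
  \<open>- y\<close> is at most \<open>- p y\<close>. It witnesses that a functional which is not linear along \<open>y\<close> is not
  minimal.\<close>

definition tilt :: "('a::real_vector \<Rightarrow> real) \<Rightarrow> 'a \<Rightarrow> 'a \<Rightarrow> real" where
  "tilt p y x = (INF t\<in>{0..}. p (x + t *\<^sub>R y) - t * p y)"

text \<open>Sublinearity bounds the family defining the infimum below by \<open>- p (- x)\<close>.\<close>

lemma tilt_lower:
  assumes p: "sublinear p" and t: "0 \<le> t"
  shows "tilt p y x \<le> p (x + t *\<^sub>R y) - t * p y"
  unfolding tilt_def
proof (rule cINF_lower)
  show "bdd_below ((\<lambda>t. p (x + t *\<^sub>R y) - t * p y) ` {0..})"
  proof (rule bdd_belowI2)
    fix t :: real assume "t \<in> {0..}"
    then show "- p (- x) \<le> p (x + t *\<^sub>R y) - t * p y"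
      using sublinear_add[OF p, of "x + t *\<^sub>R y" "- x"] sublinear_scaleR[OF p, of t y] by simp
  qed
qed (use t in simp)

lemma tilt_greatest:
  assumes "\<And>t. 0 \<le> t \<Longrightarrow> c \<le> p (x + t *\<^sub>R y) - t * p y"
  shows "c \<le> tilt p y x"
  unfolding tilt_def using assms by (intro cINF_greatest) auto

lemma tilt_le: "sublinear p \<Longrightarrow> tilt p y x \<le> p x"
  using tilt_lower[of p 0 y x] by simp

lemma tilt_minus_le: "sublinear p \<Longrightarrow> tilt p y (- y) \<le> - p y"
  using tilt_lower[of p 1 y "- y"] sublinear_zero[of p] by simp

text \<open>Two parameters \<open>t\<close> and \<open>s\<close> for \<open>x\<close> and \<open>z\<close> combine to \<open>t + s\<close> for \<open>x + z\<close>, and a parameter \<open>t\<close> for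
  \<open>x\<close> scales to \<open>a * t\<close> for \<open>a *\<^sub>R x\<close>.\<close>

lemma sublinear_tilt:
  assumes p: "sublinear p"
  shows "sublinear (tilt p y)"
  unfolding sublinear_def
proof (intro conjI allI impI)
  fix x z
  have "tilt p y (x + z) - (p (x + t *\<^sub>R y) - t * p y) \<le> p (z + s *\<^sub>R y) - s * p y"
    if "0 \<le> t" "0 \<le> s" for s t
    using tilt_lower[OF p, of "t + s" y "x + z"] that
      sublinear_add[OF p, of "x + t *\<^sub>R y" "z + s *\<^sub>R y"] by (simp add: algebra_simps)
  then have "tilt p y (x + z) - (p (x + t *\<^sub>R y) - t * p y) \<le> tilt p y z" if "0 \<le> t" for t
    using that by (intro tilt_greatest)
  then have "tilt p y (x + z) - tilt p y z \<le> tilt p y x"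
    by (intro tilt_greatest) (simp add: algebra_simps)
  then show "tilt p y (x + z) \<le> tilt p y x + tilt p y z" by simp
next
  fix a :: real and x assume a: "0 \<le> a"
  show "tilt p y (a *\<^sub>R x) \<le> a * tilt p y x"
  proof (cases "a = 0")
    case True
    then show ?thesis using tilt_le[OF p, of y 0] sublinear_zero[OF p] by simp
  next
    case False
    have "tilt p y (a *\<^sub>R x) / a \<le> p (x + t *\<^sub>R y) - t * p y" if t: "0 \<le> t" for t
    proof -
      have "tilt p y (a *\<^sub>R x) \<le> p (a *\<^sub>R x + (a * t) *\<^sub>R y) - a * t * p y"
        using a t by (intro tilt_lower[OF p]) simp
      also have "a *\<^sub>R x + (a * t) *\<^sub>R y = a *\<^sub>R (x + t *\<^sub>R y)" by (simp add: scaleR_add_right)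
      also have "p \<dots> - a * t * p y = a * (p (x + t *\<^sub>R y) - t * p y)"
        using sublinear_scaleR[OF p a, of "x + t *\<^sub>R y"]
        by (simp only: right_diff_distrib mult.assoc)
      finally show ?thesis using a False by (simp add: field_simps)
    qed
    then have "tilt p y (a *\<^sub>R x) / a \<le> tilt p y x" by (rule tilt_greatest)
    then show ?thesis using a False by (simp add: field_simps)
  qed
qed

text \<open>The chain condition is what makes the infimum subadditive: two members \<open>p\<close> and \<open>p'\<close>, one
  nearly optimal at \<open>x\<close> and one at \<open>y\<close>, may be replaced by the smaller of the two.\<close>

lemma sublinear_INF_chain:
  assumes C: "C \<noteq> {}" and sub: "\<And>p. p \<in> C \<Longrightarrow> sublinear p"
    and bdd: "\<And>x. bdd_below ((\<lambda>p. p x) ` C)"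
    and chain: "\<And>p p'. p \<in> C \<Longrightarrow> p' \<in> C \<Longrightarrow> p \<le> p' \<or> p' \<le> p"
  shows "sublinear (\<lambda>x. INF p\<in>C. p x)"
  unfolding sublinear_def
proof (intro conjI allI impI)
  let ?u = "\<lambda>x. INF p\<in>C. p x"
  have low: "?u x \<le> p x" if "p \<in> C" for p x
    using cINF_lower[OF bdd that] .
  fix x y
  have "?u (x + y) - p x \<le> p' y" if pp: "p \<in> C" "p' \<in> C" for p p'
  proof -
    obtain r where r: "r \<in> C" "r \<le> p" "r \<le> p'" using chain[OF pp] pp by blast
    have "?u (x + y) \<le> r x + r y" using low[OF r(1)] sublinear_add[OF sub[OF r(1)]] order_trans by blast
    then show ?thesis using le_funD[OF r(2), of x] le_funD[OF r(3), of y] by simp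
  qed
  then have "?u (x + y) - p x \<le> ?u y" if "p \<in> C" for p
    using that by (intro cINF_greatest[OF C])
  then have "?u (x + y) - ?u y \<le> p x" if "p \<in> C" for p
    using that by (simp add: algebra_simps)
  then have "?u (x + y) - ?u y \<le> ?u x" by (rule cINF_greatest[OF C])
  then show "?u (x + y) \<le> ?u x + ?u y" by simp
next
  let ?u = "\<lambda>x. INF p\<in>C. p x"
  have low: "?u x \<le> p x" if "p \<in> C" for p x
    using cINF_lower[OF bdd that] .
  fix a :: real and x assume a: "0 \<le> a"
  have le: "?u (a *\<^sub>R x) \<le> a * p x" if "p \<in> C" for p
    using low[OF that, of "a *\<^sub>R x"] sublinear_scaleR[OF sub[OF that] a] by simp
  show "?u (a *\<^sub>R x) \<le> a * ?u x"
  proof (cases "a = 0")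
    case True
    then show ?thesis using le C by force
  next
    case False
    have "?u (a *\<^sub>R x) / a \<le> p x" if "p \<in> C" for p
      using le[OF that] a False by (simp add: field_simps)
    then have "?u (a *\<^sub>R x) / a \<le> ?u x" by (rule cINF_greatest[OF C])
    then show ?thesis using a False by (simp add: field_simps)
  qed
qed

text \<open>Zorn's lemma for the reversed pointwise order. A chain below \<open>q\<close> is bounded below at \<open>x\<close>
  because each member satisfies \<open>- q (- x) \<le> - p (- x) \<le> p x\<close>.\<close>

lemma minimal_sublinear_below:
  assumes q: "sublinear q"
  shows "\<exists>p. sublinear p \<and> p \<le> q \<and> (\<forall>r. sublinear r \<longrightarrow> r \<le> p \<longrightarrow> r = p)"
proof -
  let ?A = "{p. sublinear p \<and> p \<le> q}"
  have "\<exists>m\<in>?A. \<forall>a\<in>?A. a \<le> m \<longrightarrow> a = m"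
  proof (rule predicate_Zorn[where P = "\<lambda>p r. r \<le> p"])
    show "partial_order_on ?A (relation_of (\<lambda>p r. r \<le> p) ?A)"
      by (rule partial_order_on_relation_ofI) (blast intro: order_trans antisym)+
    fix C assume "C \<in> Chains (relation_of (\<lambda>p r. r \<le> p) ?A)"
    then have C: "p \<in> ?A" if "p \<in> C" for p
      using that unfolding Chains_def relation_of_def by blast
    have chain: "p \<le> p' \<or> p' \<le> p" if "p \<in> C" "p' \<in> C" for p p'
      using that \<open>C \<in> _\<close> unfolding Chains_def relation_of_def by blast
    show "\<exists>u\<in>?A. \<forall>a\<in>C. u \<le> a"
    proof (cases "C = {}")
      case True
      then show ?thesis using q by blast
    next
      case False
      have bdd: "bdd_below ((\<lambda>p. p x) ` C)" for x
      proof (rule bdd_belowI2)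
        fix p assume "p \<in> C"
        then have "sublinear p" "p (- x) \<le> q (- x)" using C by (auto dest: le_funD)
        then show "- q (- x) \<le> p x" using sublinear_minus[of p x] by linarith
      qed
      let ?u = "\<lambda>x. INF p\<in>C. p x"
      have low: "?u \<le> p" if "p \<in> C" for p
        using cINF_lower[OF bdd that] by (intro le_funI)
      have "sublinear ?u" using C chain by (intro sublinear_INF_chain[OF False _ bdd]) auto
      moreover have "?u \<le> q" using False low C by (force intro: order_trans)
      ultimately show ?thesis using low by blast
    qed
  qed
  then show ?thesis by (blast intro: order_trans)
qed

text \<open>By minimality, tilting in any direction \<open>y\<close> changes nothing, whence \<open>p (- y) \<le> - p y\<close>. So \<open>p\<close> is
  odd, and subadditivity at \<open>x + y\<close> and at \<open>- x - y\<close> gives additivity.\<close>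

lemma minimal_sublinear_imp_linear:
  assumes p: "sublinear p" and min: "\<And>r. sublinear r \<Longrightarrow> r \<le> p \<Longrightarrow> r = p"
  shows "linear p"
proof -
  have "tilt p y = p" for y
    by (rule min[OF sublinear_tilt[OF p]]) (simp add: le_fun_def tilt_le[OF p])
  then have "p (- y) \<le> - p y" for y using tilt_minus_le[OF p, of y] by simp
  then have minus: "p (- y) = - p y" for y using sublinear_minus[OF p, of y] by (simp add: antisym)
  show ?thesis
  proof (rule linearI)
    fix x y
    show "p (x + y) = p x + p y"
      using sublinear_add[OF p, of x y] sublinear_add[OF p, of "- x" "- y"] minus[of x] minus[of y]
        minus[of "x + y"] by simp
  next
    fix a x
    show "p (a *\<^sub>R x) = a *\<^sub>R p x"
    proof (cases "0 \<le> a")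
      case False
      then show ?thesis using sublinear_scaleR[OF p, of "- a" x] minus[of "a *\<^sub>R x"] by simp
    qed (simp add: sublinear_scaleR[OF p])
  qed
qed

text \<open>This form of the Hahn--Banach theorem comes from a minimal sublinear functional below the norm
  tilted along \<open>v\<close>: the tilt forces its value at \<open>- v\<close> down to \<open>- norm v\<close>, and minimality makes
  it linear.\<close>

theorem norming_functional:
  fixes v :: "'a::real_normed_vector"
  shows "\<exists>\<phi> :: 'a \<Rightarrow> real. bounded_linear \<phi> \<and> (\<forall>x. \<bar>\<phi> x\<bar> \<le> norm x) \<and> \<phi> v = norm v"
proof -
  have N: "sublinear (norm :: 'a \<Rightarrow> real)"
    by (simp add: sublinear_def norm_triangle_ineq)
  obtain p where p: "sublinear p" "p \<le> tilt norm v" "\<And>r. sublinear r \<Longrightarrow> r \<le> p \<Longrightarrow> r = p"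
    using minimal_sublinear_below[OF sublinear_tilt[OF N]] by blast
  interpret linear p by (rule minimal_sublinear_imp_linear[OF p(1,3)])
  have le: "p x \<le> norm x" for x
    using le_funD[OF p(2), of x] tilt_le[OF N, of v x] by simp
  have abs: "\<bar>p x\<bar> \<le> norm x" for x using le[of x] le[of "- x"] neg[of x] by simp
  have "p (- v) \<le> - norm v" using le_funD[OF p(2), of "- v"] tilt_minus_le[OF N, of v] by simp
  then have "p v = norm v" using le[of v] neg[of v] by simp
  moreover have "bounded_linear p"
    by (rule bounded_linear_intro[where K = 1]) (auto simp: add scale abs)
  ultimately show ?thesis using abs by blast
qed

section \<open>Pettis integrals\<close>

text \<open>Testing against a functional that norms \<open>v\<close> turns the bound into one between scalar
  integrals. The uniqueness of Pettis integrals and every later estimate reduce to this bound.\<close>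

lemma has_pettis_integral_norm_le:
  assumes v: "has_pettis_integral \<Omega> \<xi> v" and g: "integrable \<Omega> g"
    and le: "AE \<omega> in \<Omega>. norm (\<xi> \<omega>) \<le> g \<omega>"
  shows "norm v \<le> (\<integral>\<omega>. g \<omega> \<partial>\<Omega>)"
proof -
  obtain \<phi> :: "'b \<Rightarrow> real" where \<phi>: "bounded_linear \<phi>" "\<And>x. \<bar>\<phi> x\<bar> \<le> norm x" "\<phi> v = norm v"
    using norming_functional by blast
  have i: "has_bochner_integral (completion \<Omega>) (\<lambda>\<omega>. \<phi> (\<xi> \<omega>)) (\<phi> v)"
    using v \<phi>(1) unfolding has_pettis_integral_def by blast
  have "norm v = (\<integral>\<omega>. \<phi> (\<xi> \<omega>) \<partial>completion \<Omega>)"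
    using has_bochner_integral_integral_eq[OF i] \<phi>(3) by simp
  also have "\<dots> \<le> (\<integral>\<omega>. g \<omega> \<partial>completion \<Omega>)"
  proof (rule integral_mono_AE)
    show "integrable (completion \<Omega>) (\<lambda>\<omega>. \<phi> (\<xi> \<omega>))" using i by (simp add: has_bochner_integral_iff)
    show "integrable (completion \<Omega>) g" using g by (simp add: integrable_completion)
    show "AE \<omega> in completion \<Omega>. \<phi> (\<xi> \<omega>) \<le> g \<omega>"
      using AE_completion[OF le] by eventually_elim (use \<phi>(2) in \<open>auto simp: abs_le_iff intro: order_trans\<close>)
  qed
  also have "\<dots> = (\<integral>\<omega>. g \<omega> \<partial>\<Omega>)" using g by (intro integral_completion) auto
  finally show ?thesis .
qed

lemma has_pettis_integral_diff:
  assumes "has_pettis_integral \<Omega> \<xi> v" "has_pettis_integral \<Omega> \<eta> w"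
  shows "has_pettis_integral \<Omega> (\<lambda>\<omega>. \<xi> \<omega> - \<eta> \<omega>) (v - w)"
  using assms unfolding has_pettis_integral_def
  by (auto simp: linear_diff bounded_linear.linear intro!: has_bochner_integral_diff)

lemma has_pettis_integral_unique:
  assumes "has_pettis_integral \<Omega> \<xi> v" "has_pettis_integral \<Omega> \<xi> w"
  shows "v = w"
  using has_pettis_integral_norm_le[OF has_pettis_integral_diff[OF assms], of "\<lambda>_. 0"] by simp

lemma pettis_integral_eq:
  assumes "has_pettis_integral \<Omega> \<xi> v"
  shows "pettis_integral \<Omega> \<xi> = v"
  unfolding pettis_integral_def using assms has_pettis_integral_unique by blast

lemma has_pettis_integral_simple:
  assumes "finite_measure \<Omega>" "simple_function \<Omega> s"
  shows "has_pettis_integral \<Omega> s (Bochner_Integration.simple_bochner_integral \<Omega> s)"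
  unfolding has_pettis_integral_def
proof (intro allI impI)
  fix \<phi> :: "'b \<Rightarrow> real" assume "bounded_linear \<phi>"
  then have "linear \<phi>" by (rule bounded_linear.linear)
  have fin: "emeasure \<Omega> A \<noteq> \<infinity>" for A
    using finite_measure.emeasure_finite[OF assms(1)] by simp
  have s: "Bochner_Integration.simple_bochner_integrable \<Omega> s"
    using assms(2) fin by (simp add: simple_bochner_integrable.simps)
  have "Bochner_Integration.simple_bochner_integrable \<Omega> (\<lambda>\<omega>. \<phi> (s \<omega>))"
    using simple_function_compose1[OF assms(2)] fin by (simp add: simple_bochner_integrable.simps)
  from has_bochner_integral_simple_bochner_integrable[OF this]
  have "has_bochner_integral \<Omega> (\<lambda>\<omega>. \<phi> (s \<omega>)) (\<phi> (Bochner_Integration.simple_bochner_integral \<Omega> s))"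
    by (simp add: simple_bochner_integral_linear[OF \<open>linear \<phi>\<close> s])
  then show "has_bochner_integral (completion \<Omega>) (\<lambda>\<omega>. \<phi> (s \<omega>)) (\<phi> (Bochner_Integration.simple_bochner_integral \<Omega> s))"
    by (auto simp: has_bochner_integral_iff integrable_completion integral_completion)
qed

lemma (in prob_space) has_pettis_integral_const: "has_pettis_integral M (\<lambda>_. w) w"
proof -
  interpret c: prob_space "completion M" by (rule prob_space_completion)
  show ?thesis
    using c.prob_space by (simp add: has_pettis_integral_def has_bochner_integral_iff)
qed

lemma (in complete_measure) measurable_AE_eq:
  assumes f: "f \<in> measurable M N" and eq: "AE x in M. f x = g x" and g: "g \<in> space M \<rightarrow> space N"
  shows "g \<in> measurable M N"
proof (rule measurableI)
  fix A assume A: "A \<in> sets N"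
  \<comment> \<open>completeness is used for the part of the preimage inside this null set\<close>
  define Z where "Z = {x \<in> space M. f x \<noteq> g x}"
  have Z: "Z \<in> null_sets M" using eq unfolding AE_iff_null_sets Z_def .
  have "Z \<inter> g -` A \<in> sets M" by (rule complete[OF Int_lower1 Z])
  moreover have "f -` A \<inter> space M - Z \<in> sets M" using measurable_sets[OF f A] Z by auto
  moreover have "g -` A \<inter> space M = (Z \<inter> g -` A) \<union> (f -` A \<inter> space M - Z)"
    by (auto simp: Z_def)
  ultimately show "g -` A \<inter> space M \<in> sets M" by auto
qed (use g in auto)

text \<open>The integrals of the approximants form a Cauchy sequence by the norm bound, and their limit is
  the integral of \<open>\<xi>\<close>. The scalar functions \<open>\<phi> \<circ> \<xi>\<close> are limits of measurable functions almost
  everywhere, hence measurable for the completed measure.\<close>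

lemma (in prob_space) has_pettis_integral_uniform_limit:
  assumes s: "\<And>m::nat. has_pettis_integral M (s m) (v m)"
    and close: "\<And>m. AE \<omega> in M. norm (s m \<omega> - \<xi> \<omega>) \<le> e m" and e: "e \<longlonglongrightarrow> 0"
  shows "\<exists>w. has_pettis_integral M \<xi> w"
proof -
  interpret c: prob_space "completion M" by (rule prob_space_completion)
  note close' = AE_completion[OF close]
  have diff: "norm (v m - v l) \<le> e m + e l" for m l
  proof -
    have "AE \<omega> in M. norm (s m \<omega> - s l \<omega>) \<le> e m + e l"
      using close[of m] close[of l]
    proof eventually_elim
      case (elim \<omega>)
      then show ?case using norm_triangle_ineq4[of "s m \<omega> - \<xi> \<omega>" "s l \<omega> - \<xi> \<omega>"] by simp
    qed
    from has_pettis_integral_norm_le[OF has_pettis_integral_diff[OF s s] _ this]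
    show ?thesis by (simp add: prob_space)
  qed
  have "Cauchy v"
  proof (rule metric_CauchyI)
    fix r :: real assume "0 < r"
    then have "\<forall>\<^sub>F m in sequentially. e m < r / 2" using e by (intro order_tendstoD(2)[OF e]) simp
    then obtain N where N: "\<And>m. m \<ge> N \<Longrightarrow> e m < r / 2" unfolding eventually_sequentially by blast
    then have "dist (v m) (v l) < r" if "m \<ge> N" "l \<ge> N" for m l
      using diff[of m l] N[OF that(1)] N[OF that(2)] by (simp add: dist_norm)
    then show "\<exists>N. \<forall>m\<ge>N. \<forall>n\<ge>N. dist (v m) (v n) < r" by blast
  qed
  then obtain w where w: "v \<longlonglongrightarrow> w" using Cauchy_convergent convergent_def by blast
  have "has_bochner_integral (completion M) (\<lambda>\<omega>. \<phi> (\<xi> \<omega>)) (\<phi> w)"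
    if \<phi>: "bounded_linear \<phi>" for \<phi> :: "'b \<Rightarrow> real"
  proof -
    interpret bounded_linear \<phi> by (rule \<phi>)
    obtain K where K: "0 < K" "\<And>x. norm (\<phi> x) \<le> norm x * K" using pos_bounded by blast
    have i: "has_bochner_integral (completion M) (\<lambda>\<omega>. \<phi> (s m \<omega>)) (\<phi> (v m))" for m
      using s \<phi> unfolding has_pettis_integral_def by blast
    have [measurable]: "(\<lambda>\<omega>. \<phi> (s m \<omega>)) \<in> borel_measurable (completion M)" for m
      using i[of m] by (auto simp: has_bochner_integral_iff)
    have "AE \<omega> in completion M. \<forall>m. norm (s m \<omega> - \<xi> \<omega>) \<le> e m"
      using close' by (simp add: AE_all_countable)
    then have "AE \<omega> in completion M. lim (\<lambda>m. \<phi> (s m \<omega>)) = \<phi> (\<xi> \<omega>)"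
    proof eventually_elim
      case (elim \<omega>)
      have "(\<lambda>m. s m \<omega> - \<xi> \<omega>) \<longlonglongrightarrow> 0" using elim by (intro Lim_null_comparison[OF _ e]) simp
      then have "(\<lambda>m. s m \<omega>) \<longlonglongrightarrow> \<xi> \<omega>" by (simp add: LIM_zero_iff)
      then show ?case by (intro limI tendsto)
    qed
    then have meas[measurable]: "(\<lambda>\<omega>. \<phi> (\<xi> \<omega>)) \<in> borel_measurable (completion M)"
      by (rule completion.measurable_AE_eq[rotated]) simp_all
    have small: "AE \<omega> in completion M. norm (\<phi> (s m \<omega>) - \<phi> (\<xi> \<omega>)) \<le> K * e m" for m
      using close'[of m]
    proof eventually_elim
      case (elim \<omega>)
      have "norm (\<phi> (s m \<omega> - \<xi> \<omega>)) \<le> norm (s m \<omega> - \<xi> \<omega>) * K" by (rule K)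
      also have "\<dots> \<le> e m * K" using elim K(1) by simp
      finally show ?case by (simp add: diff mult.commute)
    qed
    have dint: "integrable (completion M) (\<lambda>\<omega>. \<phi> (s m \<omega>) - \<phi> (\<xi> \<omega>))" for m
      by (rule Bochner_Integration.integrable_bound[where f = "\<lambda>_. K * e m"])
        (use small[of m] in \<open>auto elim!: eventually_mono\<close>)
    have "integrable (completion M) (\<lambda>\<omega>. \<phi> (s 0 \<omega>) - (\<phi> (s 0 \<omega>) - \<phi> (\<xi> \<omega>)))"
      by (intro Bochner_Integration.integrable_diff dint) (use i[of 0] in \<open>simp add: has_bochner_integral_iff\<close>)
    then have int: "integrable (completion M) (\<lambda>\<omega>. \<phi> (\<xi> \<omega>))" by simp
    have "norm (\<phi> (v m) - (\<integral>\<omega>. \<phi> (\<xi> \<omega>) \<partial>completion M)) \<le> K * e m" for m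
    proof -
      have "\<phi> (v m) - (\<integral>\<omega>. \<phi> (\<xi> \<omega>) \<partial>completion M)
        = (\<integral>\<omega>. \<phi> (s m \<omega>) - \<phi> (\<xi> \<omega>) \<partial>completion M)"
        using i[of m] int by (simp add: has_bochner_integral_iff)
      also have "norm \<dots> \<le> (\<integral>\<omega>. norm (\<phi> (s m \<omega>) - \<phi> (\<xi> \<omega>)) \<partial>completion M)"
        by (rule Bochner_Integration.integral_norm_bound)
      also have "\<dots> \<le> (\<integral>\<omega>. K * e m \<partial>completion M)"
        by (intro integral_mono_AE integrable_norm dint small) simp
      finally show ?thesis using c.prob_space by simp
    qed
    then have "(\<lambda>m. \<phi> (v m) - (\<integral>\<omega>. \<phi> (\<xi> \<omega>) \<partial>completion M)) \<longlonglongrightarrow> 0"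
      by (intro Lim_null_comparison[OF always_eventually tendsto_mult_right_zero[OF e]] allI)
    then have "(\<lambda>m. \<phi> (v m)) \<longlonglongrightarrow> (\<integral>\<omega>. \<phi> (\<xi> \<omega>) \<partial>completion M)" by (simp add: LIM_zero_iff)
    with tendsto[OF w] have "\<phi> w = (\<integral>\<omega>. \<phi> (\<xi> \<omega>) \<partial>completion M)" by (rule LIMSEQ_unique)
    then show ?thesis using int by (simp add: has_bochner_integral_iff)
  qed
  then show ?thesis unfolding has_pettis_integral_def by blast
qed

section \<open>The hyperspace of a compact set\<close>

lemma Rep_Abs_compacts: "compact A \<Longrightarrow> A \<noteq> {} \<Longrightarrow> Rep_compacts (Abs_compacts A) = A"
  by (simp add: Abs_compacts_inverse)

lemma dist_compacts_le_iff:
  assumes "0 \<le> r"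
  shows "dist A B \<le> r \<longleftrightarrow> (\<forall>a\<in>Rep_compacts A. infdist a (Rep_compacts B) \<le> r)
    \<and> (\<forall>b\<in>Rep_compacts B. infdist b (Rep_compacts A) \<le> r)"
  unfolding dist_compacts_def by (intro hausdorff_dist_le_iff Rep_compacts_simps assms)

lemma compact_near_point:
  assumes "compact A" "A \<noteq> {}"
  shows "\<exists>a\<in>A. dist x a = infdist x A"
proof -
  obtain a where a: "a \<in> A" "\<And>b. b \<in> A \<Longrightarrow> dist x a \<le> dist x b"
    using continuous_attains_inf[OF assms continuous_on_dist[OF continuous_on_const continuous_on_id]]
    by blast
  have "dist x a \<le> infdist x A"
    unfolding infdist_notempty[OF assms(2)] by (rule cINF_greatest[OF assms(2) a(2)])
  then show ?thesis using a(1) infdist_le[OF a(1)] by (metis antisym)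
qed

lemma infdist_compacts_le:
  "infdist x (Rep_compacts B) \<le> infdist x (Rep_compacts A) + dist A B"
proof -
  obtain a where a: "a \<in> Rep_compacts A" "dist x a = infdist x (Rep_compacts A)"
    using compact_near_point[OF Rep_compacts_simps] by blast
  have "infdist a (Rep_compacts B) \<le> dist A B"
    using a(1) dist_compacts_le_iff[of "dist A B" A B] by simp
  then show ?thesis using infdist_triangle[of x "Rep_compacts B" a] a(2) by linarith
qed

definition hyperspace :: "'a::metric_space set \<Rightarrow> 'a compacts set" where
  "hyperspace C = {A. Rep_compacts A \<subseteq> C}"

text \<open>A Cauchy sequence \<open>A n\<close> converges to the set of all points of \<open>C\<close> whose distance to
  \<open>A n\<close> tends to 0. That each point of \<open>A n\<close> is near this set uses compactness of \<open>C\<close>: its nearest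
  points in the sets \<open>A m\<close> accumulate somewhere in \<open>C\<close>.\<close>

lemma complete_hyperspace:
  fixes C :: "'a::metric_space set"
  assumes C: "compact C"
  shows "uniform_space_class.complete (hyperspace C)"
proof (rule completeI)
  fix A :: "nat \<Rightarrow> 'a compacts"
  assume "\<forall>n. A n \<in> hyperspace C" and cau: "Cauchy A"
  then have sub: "Rep_compacts (A n) \<subseteq> C" for n by (simp add: hyperspace_def)
  define L where "L = {x \<in> C. (\<lambda>n. infdist x (Rep_compacts (A n))) \<longlonglongrightarrow> 0}"
  \<comment> \<open>The limit set is approached from the sets \<open>A n\<close>; this also shows that it is nonempty.\<close>
  have near: "\<exists>a\<in>L. dist b a \<le> e"
    if N: "\<And>m. m \<ge> N \<Longrightarrow> dist (A n) (A m) \<le> e" and b: "b \<in> Rep_compacts (A n)" for N n e b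
  proof -
    have "\<exists>a\<in>Rep_compacts (A m). dist b a = infdist b (Rep_compacts (A m))" for m
      by (rule compact_near_point[OF Rep_compacts_simps])
    then obtain y where y: "\<And>m. y m \<in> Rep_compacts (A m)"
      "\<And>m. dist b (y m) = infdist b (Rep_compacts (A m))" by metis
    have yle: "dist b (y m) \<le> e" if "m \<ge> N" for m
      using y(2)[of m] infdist_compacts_le[of b "A m" "A n"] b N[OF that] by simp
    have "\<forall>m. y m \<in> C" using y(1) sub by blast
    then obtain a and r :: "nat \<Rightarrow> nat" where a: "a \<in> C" "strict_mono r" "(y \<circ> r) \<longlonglongrightarrow> a"
      using C unfolding compact_def by metis
    have "(\<lambda>n. infdist a (Rep_compacts (A n))) \<longlonglongrightarrow> 0"
    proof (rule metric_LIMSEQ_I)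
      fix \<epsilon> :: real assume \<epsilon>: "0 < \<epsilon>"
      obtain K where K: "\<And>n m. n \<ge> K \<Longrightarrow> m \<ge> K \<Longrightarrow> dist (A n) (A m) < \<epsilon> / 2"
        using metric_CauchyD[OF cau, of "\<epsilon> / 2"] \<epsilon> by auto
      have "\<forall>\<^sub>F k in sequentially. dist ((y \<circ> r) k) a < \<epsilon> / 2"
        using a(3) \<epsilon> by (intro tendstoD) (simp_all del: comp_apply)
      then obtain k where k: "k \<ge> K" "dist (y (r k)) a < \<epsilon> / 2"
        unfolding eventually_sequentially by (metis comp_apply nle_le)
      have rk: "r k \<ge> K" using k(1) seq_suble[OF a(2), of k] by simp
      have "infdist a (Rep_compacts (A (r k))) < \<epsilon> / 2"
        using infdist_le[OF y(1), of a "r k"] k(2) by (simp add: dist_commute)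
      then have "infdist a (Rep_compacts (A n)) < \<epsilon>" if "n \<ge> K" for n
        using infdist_compacts_le[of a "A n" "A (r k)"] K[OF rk that] by linarith
      then show "\<exists>K. \<forall>n\<ge>K. dist (infdist a (Rep_compacts (A n))) 0 < \<epsilon>"
        by (intro exI[of _ K]) (simp add: infdist_nonneg)
    qed
    then have "a \<in> L" using a(1) by (simp add: L_def)
    moreover have "dist b a \<le> e"
    proof (rule LIMSEQ_le_const2)
      show "(\<lambda>k. dist b ((y \<circ> r) k)) \<longlonglongrightarrow> dist b a" by (intro tendsto_intros a(3))
      show "\<exists>K. \<forall>k\<ge>K. dist b ((y \<circ> r) k) \<le> e"
        using yle seq_suble[OF a(2)] by (intro exI[of _ N]) (auto intro: order_trans)
    qed
    ultimately show ?thesis by blast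
  qed
  have ne: "L \<noteq> {}"
  proof -
    obtain N where N: "\<And>m. m \<ge> N \<Longrightarrow> dist (A N) (A m) \<le> 1"
      using metric_CauchyD[OF cau, of 1] by (metis less_imp_le nle_le zero_less_one)
    obtain b where "b \<in> Rep_compacts (A N)" using Rep_compacts_simps(2) by blast
    then show ?thesis using near[OF N] by blast
  qed
  have "closed L"
  proof -
    have "x \<in> L" if x: "\<And>e. e > 0 \<Longrightarrow> \<exists>y\<in>L. dist y x < e" for x
    proof -
      have "L \<subseteq> C" by (auto simp: L_def)
      then have "x \<in> C" using x closed_approachable[OF compact_imp_closed[OF C]] by (meson subsetD)
      moreover have "(\<lambda>n. infdist x (Rep_compacts (A n))) \<longlonglongrightarrow> 0"
      proof (rule metric_LIMSEQ_I)
        fix e :: real assume e: "0 < e"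
        then obtain y where y: "y \<in> L" "dist y x < e / 2" using x[of "e / 2"] by auto
        have "\<forall>\<^sub>F n in sequentially. infdist y (Rep_compacts (A n)) < e / 2"
          using y(1) e unfolding L_def by (intro order_tendstoD(2)) auto
        then have "\<forall>\<^sub>F n in sequentially. dist (infdist x (Rep_compacts (A n))) 0 < e"
        proof eventually_elim
          case (elim n)
          then show ?case using infdist_triangle[of x "Rep_compacts (A n)" y] y(2)
            by (simp add: infdist_nonneg dist_commute)
        qed
        then show "\<exists>K. \<forall>n\<ge>K. dist (infdist x (Rep_compacts (A n))) 0 < e"
          by (simp add: eventually_sequentially)
      qed
      ultimately show ?thesis by (simp add: L_def)
    qed
    then have "closure L \<subseteq> L" by (meson closure_approachable subsetI)
    then show ?thesis by (simp add: closure_subset_eq)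
  qed
  then have cL: "compact L" using compact_Int_closed[OF C, of L] unfolding L_def by (simp add: Int_absorb1 Int_def)
  note RL = Rep_Abs_compacts[OF cL ne]
  have "A \<longlonglongrightarrow> Abs_compacts L"
  proof (rule metric_LIMSEQ_I)
    fix e :: real assume e: "0 < e"
    obtain N where N: "\<And>n m. n \<ge> N \<Longrightarrow> m \<ge> N \<Longrightarrow> dist (A n) (A m) < e / 2"
      using metric_CauchyD[OF cau, of "e / 2"] e by auto
    have "dist (A n) (Abs_compacts L) \<le> e / 2" if n: "n \<ge> N" for n
    proof (subst dist_compacts_le_iff, goal_cases)
      case 2
      show ?case unfolding RL
      proof (intro conjI ballI)
        fix b assume b: "b \<in> Rep_compacts (A n)"
        have "\<exists>a\<in>L. dist b a \<le> e / 2"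
          by (rule near[OF _ b, of N]) (use N n in \<open>auto intro: less_imp_le\<close>)
        then show "infdist b L \<le> e / 2" using infdist_le2 by blast
      next
        fix a assume "a \<in> L"
        then have lim: "(\<lambda>m. infdist a (Rep_compacts (A m)) + e / 2) \<longlonglongrightarrow> 0 + e / 2"
          unfolding L_def by (intro tendsto_intros) simp
        have le: "infdist a (Rep_compacts (A n)) \<le> infdist a (Rep_compacts (A m)) + e / 2" if "m \<ge> N" for m
          using infdist_compacts_le[of a "A n" "A m"] N[OF that n] by linarith
        have "infdist a (Rep_compacts (A n)) \<le> 0 + e / 2"
          by (rule LIMSEQ_le_const[OF lim]) (use le in blast)
        then show "infdist a (Rep_compacts (A n)) \<le> e / 2" by simp
      qed
    qed (use e in simp)
    then show "\<exists>N. \<forall>n\<ge>N. dist (A n) (Abs_compacts L) < e"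
      using e by (intro exI[of _ N]) (fastforce intro: le_less_trans)
  qed
  moreover have "Abs_compacts L \<in> hyperspace C" by (simp add: hyperspace_def RL) (simp add: L_def)
  ultimately show "\<exists>l\<in>hyperspace C. A \<longlonglongrightarrow> l" by blast
qed

lemma compact_imp_finite_net:
  fixes C :: "'a::metric_space set"
  assumes "compact C" "0 < e"
  shows "\<exists>N. finite N \<and> N \<subseteq> C \<and> C \<subseteq> (\<Union>x\<in>N. ball x e)"
  using compactE_image[OF assms(1), of C "\<lambda>x. ball x e"] assms(2) by (metis UN_I centre_in_ball open_ball subsetI)

text \<open>Blaschke's selection theorem. Total boundedness holds because the nonempty subsets of a finite
  \<open>e / 2\<close>-net of \<open>C\<close> form a finite \<open>e\<close>-net of the hyperspace.\<close>

lemma compact_hyperspace: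
  fixes C :: "'a::metric_space set"
  assumes C: "compact C"
  shows "compact (hyperspace C)"
  unfolding compact_eq_totally_bounded
proof (intro conjI allI impI complete_hyperspace[OF C])
  fix e :: real assume e: "0 < e"
  obtain N where N: "finite N" "N \<subseteq> C" "C \<subseteq> (\<Union>x\<in>N. ball x (e / 2))"
    using compact_imp_finite_net[OF C, of "e / 2"] e by auto
  have "\<exists>P\<in>Pow N. A \<in> ball (Abs_compacts P) e" if A: "A \<in> hyperspace C" for A
  proof -
    \<comment> \<open>the net points close to \<open>A\<close>, so that both sets lie within \<open>e / 2\<close> of each other\<close>
    define P where "P = {x \<in> N. infdist x (Rep_compacts A) \<le> e / 2}"
    have P: "\<exists>x\<in>P. dist a x \<le> e / 2" if a: "a \<in> Rep_compacts A" for a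
    proof -
      obtain x where x: "x \<in> N" "dist x a < e / 2"
        using a A N(3) unfolding hyperspace_def by (auto simp: subset_iff)
      then have "x \<in> P" using infdist_le[OF a, of x] by (simp add: P_def)
      then show ?thesis using x by (intro bexI[of _ x]) (auto simp: dist_commute)
    qed
    have "finite P" using N(1) by (simp add: P_def)
    moreover have "P \<noteq> {}" using P Rep_compacts_simps(2)[of A] by blast
    ultimately have R: "Rep_compacts (Abs_compacts P) = P"
      by (intro Rep_Abs_compacts finite_imp_compact)
    have "infdist a P \<le> e / 2" if "a \<in> Rep_compacts A" for a
      using P[OF that] infdist_le2 by blast
    then have "dist (Abs_compacts P) A \<le> e / 2"
      using e by (subst dist_compacts_le_iff) (simp_all add: R, simp add: P_def)
    then show ?thesis using e by (intro bexI[of _ P]) (auto simp: P_def)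
  qed
  then show "\<exists>k. finite k \<and> hyperspace C \<subseteq> (\<Union>A\<in>k. ball A e)"
    using N(1) by (intro exI[of _ "Abs_compacts ` Pow N"]) auto
qed

section \<open>Samples\<close>

lemma Rep_sample:
  assumes "1 \<le> n" shows "Rep_compacts (sample X n \<omega>) = (\<lambda>i. X i \<omega>) ` {..<n}"
  unfolding sample_def using assms by (intro Rep_Abs_compacts finite_imp_compact) (auto simp: lessThan_empty_iff)

lemma sample_in_hyperspace:
  assumes "1 \<le> n" "\<And>i. Y i \<omega> \<in> C" shows "sample Y n \<omega> \<in> hyperspace C"
  using assms by (auto simp: hyperspace_def Rep_sample)

lemma dist_sample_le:
  assumes n: "1 \<le> n" and le: "\<And>i. i < n \<Longrightarrow> dist (X i \<omega>) (Y i \<omega>) \<le> r"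
  shows "dist (sample X n \<omega>) (sample Y n \<omega>) \<le> r"
proof -
  have "dist (X 0 \<omega>) (Y 0 \<omega>) \<le> r" using n le by simp
  then have r: "0 \<le> r" using zero_le_dist order_trans by blast
  have "infdist (X i \<omega>) ((\<lambda>i. Y i \<omega>) ` {..<n}) \<le> r" "infdist (Y i \<omega>) ((\<lambda>i. X i \<omega>) ` {..<n}) \<le> r"
    if "i < n" for i
    using that le[OF that] by (auto intro!: infdist_le2 simp: dist_commute)
  then show ?thesis by (subst dist_compacts_le_iff[OF r]) (auto simp: Rep_sample[OF n])
qed

text \<open>Rounding to a finite net by a Borel map with finitely many values makes samples simple
  functions, even if the Borel sets of the metric space are not countably generated.\<close>

lemma finite_net_nearest_point:
  fixes N :: "'a::metric_space set"
  assumes "finite N" "N \<noteq> {}"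
  shows "\<exists>r. simple_function borel r \<and> range r \<subseteq> N \<and> (\<forall>x\<in>(\<Union>c\<in>N. ball c e). dist x (r x) < e)"
  using assms
proof (induction rule: finite_ne_induct)
  case (singleton c)
  then show ?case by (intro exI[of _ "\<lambda>_. c"]) (auto simp: dist_commute)
next
  case (insert c N)
  then obtain r where r: "simple_function borel r" "range r \<subseteq> N"
    "\<forall>x\<in>(\<Union>c\<in>N. ball c e). dist x (r x) < e" by blast
  have "simple_function borel (\<lambda>x. if x \<in> ball c e then c else r x)"
    by (intro simple_function_If r(1) simple_function_const) (simp del: mem_ball)
  then show ?case using r(2,3)
    by (intro exI[of _ "\<lambda>x. if x \<in> ball c e then c else r x"]) (auto simp: dist_commute)
qed

lemma simple_function_sample:
  assumes "\<And>i. simple_function M (Y i)"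
  shows "simple_function M (sample Y n)"
proof -
  have "simple_function M (\<lambda>\<omega>. (\<lambda>i. Y i \<omega>) ` {..<n})"
  proof (induction n)
    case (Suc n)
    then show ?case
      using simple_function_compose2[OF assms[of n] Suc, of insert] by (simp add: lessThan_Suc)
  qed simp
  then have "simple_function M (\<lambda>\<omega>. Abs_compacts ((\<lambda>i. Y i \<omega>) ` {..<n}))"
    by (rule simple_function_compose1)
  then show ?thesis unfolding sample_def[abs_def] .
qed

section \<open>Sampling from a distribution with compact support\<close>

text \<open>A point outside the support has a null neighbourhood. Within the closure of \<open>D\<close>, these
  neighbourhoods may be shrunk to the countably many null balls with centre in \<open>D\<close> and rational
  radius.\<close>

lemma AE_in_msupport:
  assumes sets: "sets \<mu> = sets borel" and D: "countable D" "AE x in \<mu>. x \<in> closure D"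
  shows "AE x in \<mu>. x \<in> msupport \<mu>"
proof -
  define I where "I = {(d, q). d \<in> D \<and> q \<in> \<rat> \<and> emeasure \<mu> (ball d q) = 0}"
  have "I \<subseteq> D \<times> \<rat>" by (auto simp: I_def)
  then have cI: "countable I" by (rule countable_subset) (simp add: countable_rat D(1))
  have "AE x in \<mu>. \<forall>(d, q)\<in>I. x \<notin> ball d q"
    unfolding AE_ball_countable[OF cI]
  proof safe
    fix d q assume "(d, q) \<in> I"
    then have "ball d q \<in> null_sets \<mu>" by (auto simp: I_def null_sets_def sets)
    from AE_not_in[OF this] show "AE x in \<mu>. x \<notin> ball d q" .
  qed
  with D(2) show ?thesis
  proof eventually_elim
    case (elim x)
    show ?case
    proof (rule ccontr)
      assume "x \<notin> msupport \<mu>"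
      then obtain e where e: "0 < e" "emeasure \<mu> (ball x e) = 0"
        by (auto simp: msupport_def not_less)
      obtain q where q: "q \<in> \<rat>" "0 < q" "q < e / 2" using Rats_dense_in_real[of 0 "e / 2"] e(1) by auto
      obtain d where d: "d \<in> D" "dist d x < q" using elim(1) q(2) unfolding closure_approachable by blast
      have "ball d q \<subseteq> ball x e"
      proof
        fix y assume "y \<in> ball d q"
        then show "y \<in> ball x e" using dist_triangle[of x y d] d(2) q(3) by (simp add: dist_commute)
      qed
      then have "emeasure \<mu> (ball d q) \<le> emeasure \<mu> (ball x e)"
        by (rule emeasure_mono) (simp add: sets)
      then have "(d, q) \<in> I" using d(1) q(1) e(2) by (simp add: I_def)
      then have "x \<notin> ball d q" using elim(2) by blast
      then show False using d(2) by simp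
    qed
  qed
qed

context prob_space
begin

context
  fixes X :: "nat \<Rightarrow> 'a \<Rightarrow> 'm::metric_space" and C :: "'m set"
  assumes random: "\<And>i. random_element M (X i)"
    and indep: "indep_vars (\<lambda>_. borel) X UNIV"
    and ident: "\<And>i. distr M borel (X i) = distr M borel (X 0)"
    and compact: "compact C"
    and support: "msupport (distr M borel (X 0)) = C"
begin

lemma measurable_sample_point[measurable]: "X i \<in> borel_measurable M"
  using random by (simp add: random_element_def)

lemma AE_sample_in_support: "AE \<omega> in M. \<forall>i. X i \<omega> \<in> C"
  unfolding AE_all_countable
proof
  fix i
  obtain D where "countable D" "AE \<omega> in M. X i \<omega> \<in> closure D"
    using random[of i] by (auto simp: random_element_def)
  then have "AE x in distr M borel (X i). x \<in> msupport (distr M borel (X i))"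
    by (intro AE_in_msupport[of _ D]) (simp_all add: AE_distr_iff)
  then have "AE x in distr M borel (X i). x \<in> C" using support ident[of i] by simp
  then show "AE \<omega> in M. X i \<omega> \<in> C"
    using compact by (simp add: AE_distr_iff compact_imp_closed)
qed

lemma support_nonempty: "C \<noteq> {}"
proof
  assume "C = {}"
  then have "AE \<omega> in M. False" using AE_sample_in_support by simp
  then show False by simp
qed

definition miss :: "'m \<Rightarrow> real \<Rightarrow> nat \<Rightarrow> 'a set" where
  "miss c e n = {\<omega> \<in> space M. \<forall>i<n. X i \<omega> \<notin> ball c e}"

lemma sets_miss[measurable]: "miss c e n \<in> events"
proof -
  have "miss c e n = space M - (\<Union>i<n. X i -` ball c e \<inter> space M)"
    unfolding miss_def by blast
  moreover have "X i -` ball c e \<inter> space M \<in> events" for i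
    by (rule measurable_sets[OF measurable_sample_point]) simp
  ultimately show ?thesis by (simp only:) (intro sets.Diff sets.top sets.finite_UN finite_lessThan)
qed

text \<open>A ball around a support point has positive probability \<open>p\<close>, and by independence the
  first \<open>n\<close> points all miss it with probability \<open>(1 - p) ^ n\<close>.\<close>

lemma prob_miss_tendsto_0:
  assumes c: "c \<in> C" and e: "0 < e"
  shows "(\<lambda>n. prob (miss c e n)) \<longlonglongrightarrow> 0"
proof -
  define p where "p = prob (X 0 -` ball c e \<inter> space M)"
  have same: "prob (X i -` ball c e \<inter> space M) = p" for i
    using measure_distr[of "X i" M borel "ball c e"] measure_distr[of "X 0" M borel "ball c e"] ident[of i]
    by (simp add: p_def)
  have "0 < emeasure (distr M borel (X 0)) (ball c e)"
    using c e support unfolding msupport_def by blast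
  then have p: "0 < p" by (simp add: p_def emeasure_distr emeasure_eq_measure)
  have out: "prob (X i -` (- ball c e) \<inter> space M) = 1 - p" for i
  proof -
    have "X i -` (- ball c e) \<inter> space M = space M - (X i -` ball c e \<inter> space M)" by blast
    then show ?thesis using same[of i] by (simp only:) (subst prob_compl, simp_all)
  qed
  have "prob (miss c e n) = (1 - p) ^ n" if n: "1 \<le> n" for n
  proof -
    have "miss c e n = (\<Inter>i\<in>{..<n}. X i -` (- ball c e) \<inter> space M)"
      using n unfolding miss_def by (blast intro: less_le_trans[OF zero_less_one])
    also have "prob \<dots> = (\<Prod>i<n. prob (X i -` (- ball c e) \<inter> space M))"
      using n by (intro indep_varsD[OF indep]) (auto simp: lessThan_empty_iff)
    also have "\<dots> = (1 - p) ^ n" by (simp only: out) simp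
    finally show ?thesis .
  qed
  moreover have "(\<lambda>n. (1 - p) ^ n) \<longlonglongrightarrow> 0"
    using p by (intro LIMSEQ_power_zero) (auto simp: p_def)
  ultimately show ?thesis
    by (subst tendsto_cong[where g = "\<lambda>n. (1 - p) ^ n"])
      (auto simp: eventually_sequentially intro!: exI[of _ 1])
qed

text \<open>If no ball of an \<open>e\<close>-net of \<open>C\<close> is missed, each point of \<open>C\<close> is within \<open>e\<close> of the
  net, and the net within \<open>e\<close> of the sample.\<close>

lemma dist_sample_support_le:
  assumes n: "1 \<le> n" and e: "0 < e" and N: "C \<subseteq> (\<Union>c\<in>N. ball c e)"
    and in_C: "\<And>i. X i \<omega> \<in> C" and \<omega>: "\<omega> \<in> space M" "\<And>c. c \<in> N \<Longrightarrow> \<omega> \<notin> miss c e n"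
  shows "dist (sample X n \<omega>) (Abs_compacts C) \<le> 2 * e"
proof -
  have "infdist x ((\<lambda>i. X i \<omega>) ` {..<n}) \<le> 2 * e" if "x \<in> C" for x
  proof -
    obtain c where c: "c \<in> N" "dist c x < e" using subsetD[OF N \<open>x \<in> C\<close>] by auto
    then obtain i where i: "i < n" "dist c (X i \<omega>) < e" using \<omega> by (auto simp: miss_def)
    have "dist x (X i \<omega>) \<le> 2 * e" using dist_triangle[of x "X i \<omega>" c] c i by (simp add: dist_commute)
    then show ?thesis using i(1) by (intro infdist_le2) auto
  qed
  then show ?thesis
    using e in_C by (subst dist_compacts_le_iff)
      (auto simp: Rep_sample[OF n] Rep_Abs_compacts[OF compact support_nonempty])
qed

text \<open>Rounding the sample points to ever finer nets of \<open>C\<close> changes \<open>F\<close> of the sample uniformly little,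
  because \<open>F\<close> is uniformly continuous on the compact hyperspace of \<open>C\<close>. The rounded variables are
  simple.\<close>

lemma has_pettis_integral_sample:
  fixes F :: "'m compacts \<Rightarrow> 'v::banach"
  assumes F: "continuous_on UNIV F" and n: "1 \<le> n"
  shows "\<exists>v. has_pettis_integral M (\<lambda>\<omega>. F (sample X n \<omega>)) v"
proof -
  have "uniformly_continuous_on (hyperspace C) F"
    by (intro compact_uniformly_continuous compact_hyperspace compact continuous_on_subset[OF F]) simp
  then have uc: "\<exists>d>0. \<forall>A\<in>hyperspace C. \<forall>B\<in>hyperspace C. dist A B < d \<longrightarrow> dist (F A) (F B) < e"
    if "0 < e" for e using that unfolding uniformly_continuous_on_def by metis
  have "\<exists>s. simple_function M s \<and> (\<forall>\<omega>\<in>space M. (\<forall>i. X i \<omega> \<in> C) \<longrightarrow> norm (s \<omega> - F (sample X n \<omega>)) \<le> e)"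
    if e: "0 < e" for e
  proof -
    obtain d where d: "0 < d" "\<And>A B. A \<in> hyperspace C \<Longrightarrow> B \<in> hyperspace C \<Longrightarrow> dist A B < d \<Longrightarrow>
      dist (F A) (F B) < e" using uc[OF e] by blast
    obtain N where N: "finite N" "N \<subseteq> C" "C \<subseteq> (\<Union>x\<in>N. ball x (d / 2))"
      using compact_imp_finite_net[OF compact, of "d / 2"] d(1) by auto
    have "N \<noteq> {}" using N(3) support_nonempty by auto
    then obtain r where r: "simple_function borel r" "range r \<subseteq> N" "\<forall>x\<in>C. dist x (r x) < d / 2"
      using finite_net_nearest_point[OF N(1), of "d / 2"] N(3) by blast
    let ?Y = "\<lambda>i \<omega>. r (X i \<omega>)"
    have "simple_function M (\<lambda>\<omega>. F (sample ?Y n \<omega>))"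
      by (rule simple_function_compose1[OF simple_function_sample[OF
              simple_function_comp[OF measurable_sample_point r(1)]]])
    moreover have "norm (F (sample ?Y n \<omega>) - F (sample X n \<omega>)) \<le> e" if X: "\<forall>i. X i \<omega> \<in> C" for \<omega>
    proof -
      have "dist (sample ?Y n \<omega>) (sample X n \<omega>) \<le> d / 2"
        using r(3) X by (intro dist_sample_le[OF n]) (simp add: dist_commute less_imp_le)
      then have "dist (F (sample ?Y n \<omega>)) (F (sample X n \<omega>)) < e"
        using d(1) X r(2) N(2) by (intro d(2) sample_in_hyperspace[OF n]) auto
      then show ?thesis by (simp add: dist_norm)
    qed
    ultimately show ?thesis by blast
  qed
  from this[of "inverse (real (Suc m))" for m]
  obtain s where s: "\<And>m. simple_function M (s m)"
    "\<And>m \<omega>. \<omega> \<in> space M \<Longrightarrow> \<forall>i. X i \<omega> \<in> C \<Longrightarrow>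
      norm (s m \<omega> - F (sample X n \<omega>)) \<le> inverse (real (Suc m))" by (simp del: of_nat_Suc) metis
  show ?thesis
  proof (rule has_pettis_integral_uniform_limit)
    show "has_pettis_integral M (s m) (Bochner_Integration.simple_bochner_integral M (s m))" for m
      by (intro has_pettis_integral_simple s(1) finite_measure_axioms)
    show "AE \<omega> in M. norm (s m \<omega> - F (sample X n \<omega>)) \<le> inverse (real (Suc m))" for m
      using AE_sample_in_support AE_space by eventually_elim (use s(2) in blast)
    show "(\<lambda>m. inverse (real (Suc m))) \<longlonglongrightarrow> 0" by (rule LIMSEQ_inverse_real_of_nat)
  qed
qed

text \<open>Given \<open>\<epsilon>\<close>, choose \<open>d\<close> so that \<open>F\<close> varies by less than \<open>\<epsilon> / 2\<close> within \<open>d\<close> of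
  \<open>C\<close>. Unless the sample misses a ball of a finite \<open>d / 3\<close>-net, it lies within \<open>2 * d / 3 < d\<close> of \<open>C\<close>;
  in the exceptional case, whose probability tends to 0, the bound \<open>2 * B\<close> applies, where \<open>B\<close> bounds
  \<open>F\<close> on the hyperspace of \<open>C\<close>. The function \<open>g n\<close> collects both contributions.\<close>

theorem pettis_integral_sample_tendsto:
  fixes F :: "'m compacts \<Rightarrow> 'v::banach"
  assumes F: "continuous_on UNIV F"
  shows "(\<lambda>n. pettis_integral M (\<lambda>\<omega>. F (sample X n \<omega>))) \<longlonglongrightarrow> F (Abs_compacts C)"
proof (rule metric_LIMSEQ_I)
  fix \<epsilon> :: real assume \<epsilon>: "0 < \<epsilon>"
  have "bounded (F ` hyperspace C)"
    by (intro compact_imp_bounded compact_continuous_image compact_hyperspace compact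
        continuous_on_subset[OF F]) simp
  then obtain B where B: "0 < B" "\<And>A. A \<in> hyperspace C \<Longrightarrow> norm (F A) \<le> B"
    unfolding bounded_pos by blast
  have C_in: "Abs_compacts C \<in> hyperspace C"
    by (simp add: hyperspace_def Rep_Abs_compacts[OF compact support_nonempty])
  obtain d where d: "0 < d" "\<And>A. dist A (Abs_compacts C) < d \<Longrightarrow> dist (F A) (F (Abs_compacts C)) < \<epsilon> / 2"
    using F \<epsilon> unfolding continuous_on_iff by (meson UNIV_I half_gt_zero)
  obtain N where N: "finite N" "N \<subseteq> C" "C \<subseteq> (\<Union>x\<in>N. ball x (d / 3))"
    using compact_imp_finite_net[OF compact, of "d / 3"] d(1) by auto
  define g where "g n = (\<lambda>\<omega>. \<epsilon> / 2 + 2 * B * (\<Sum>c\<in>N. indicat_real (miss c (d / 3) n) \<omega>))" for n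
  have int_g: "integrable M (g n)" for n
    unfolding g_def by (simp add: emeasure_eq_measure)
  have g_eq: "(\<integral>\<omega>. g n \<omega> \<partial>M) = \<epsilon> / 2 + 2 * B * (\<Sum>c\<in>N. prob (miss c (d / 3) n))" for n
    unfolding g_def by (simp add: emeasure_eq_measure prob_space)
  have "dist (pettis_integral M (\<lambda>\<omega>. F (sample X n \<omega>))) (F (Abs_compacts C)) \<le> (\<integral>\<omega>. g n \<omega> \<partial>M)"
    if n: "1 \<le> n" for n
  proof -
    obtain v where v: "has_pettis_integral M (\<lambda>\<omega>. F (sample X n \<omega>)) v"
      using has_pettis_integral_sample[OF F n] by blast
    have "AE \<omega> in M. norm (F (sample X n \<omega>) - F (Abs_compacts C)) \<le> g n \<omega>"
      using AE_sample_in_support AE_space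
    proof eventually_elim
      case (elim \<omega>)
      show ?case
      proof (cases "\<exists>c\<in>N. \<omega> \<in> miss c (d / 3) n")
        case True
        then obtain c where c: "c \<in> N" "\<omega> \<in> miss c (d / 3) n" by blast
        have "indicat_real (miss c (d / 3) n) \<omega> \<le> (\<Sum>c\<in>N. indicat_real (miss c (d / 3) n) \<omega>)"
          using N(1) c(1) by (intro member_le_sum) auto
        then have "1 \<le> (\<Sum>c\<in>N. indicat_real (miss c (d / 3) n) \<omega>)" using c(2) by simp
        then have "2 * B * 1 \<le> 2 * B * (\<Sum>c\<in>N. indicat_real (miss c (d / 3) n) \<omega>)"
          using B(1) by (intro mult_left_mono) auto
        moreover have "norm (F (sample X n \<omega>)) \<le> B"
          using elim(1) by (intro B(2) sample_in_hyperspace[OF n]) simp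
        ultimately show ?thesis
          using norm_triangle_ineq4[of "F (sample X n \<omega>)" "F (Abs_compacts C)"] B(2)[OF C_in] \<epsilon>
          by (simp add: g_def)
      next
        case False
        have "dist (sample X n \<omega>) (Abs_compacts C) \<le> 2 * (d / 3)"
          using d(1) elim False by (intro dist_sample_support_le[OF n _ N(3)]) auto
        then have "dist (F (sample X n \<omega>)) (F (Abs_compacts C)) < \<epsilon> / 2" using d(1) by (intro d(2)) simp
        moreover have "0 \<le> 2 * B * (\<Sum>c\<in>N. indicat_real (miss c (d / 3) n) \<omega>)"
          using B(1) by (intro mult_nonneg_nonneg sum_nonneg) auto
        ultimately show ?thesis by (simp add: g_def dist_norm)
      qed
    qed
    from has_pettis_integral_norm_le[OF
        has_pettis_integral_diff[OF v has_pettis_integral_const] int_g this]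
    show ?thesis by (simp add: pettis_integral_eq[OF v] dist_norm)
  qed
  moreover have "\<exists>n0. \<forall>n\<ge>n0. (\<integral>\<omega>. g n \<omega> \<partial>M) < \<epsilon>"
  proof -
    have "(\<lambda>n. \<integral>\<omega>. g n \<omega> \<partial>M) \<longlonglongrightarrow> \<epsilon> / 2 + 2 * B * (\<Sum>c\<in>N. 0)"
      unfolding g_eq using N(2) d(1) by (intro tendsto_intros prob_miss_tendsto_0) auto
    then show ?thesis
      using \<epsilon> order_tendstoD(2)[of _ "\<epsilon> / 2" sequentially \<epsilon>] by (simp add: eventually_sequentially)
  qed
  ultimately show "\<exists>n0. \<forall>n\<ge>n0. dist (pettis_integral M (\<lambda>\<omega>. F (sample X n \<omega>))) (F (Abs_compacts C)) < \<epsilon>"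
    by (metis le_less_trans max.bounded_iff)
qed

end

end

section \<open>Barcodes of random samples\<close>

text \<open>Both branches of the definition are continuous: the first is a continuous extension by choice,
  well defined because such an extension is unique, and the second is constant.\<close>

lemma continuous_compact_barcode:
  "continuous_on UNIV (compact_barcode TYPE('k::field) k :: 'm::metric_space compacts \<Rightarrow> _)"
proof (cases "\<exists>f :: 'm compacts \<Rightarrow> barcode completed. is_barcode_extension TYPE('k) k f")
  case True
  then have "\<exists>!f :: 'm compacts \<Rightarrow> barcode completed. is_barcode_extension TYPE('k) k f"
    using is_barcode_extension_unique by blast
  from theI'[OF this] True
  have "is_barcode_extension TYPE('k) k (compact_barcode TYPE('k) k :: 'm compacts \<Rightarrow> _)"
    by (simp add: compact_barcode_def)
  then show ?thesis by (simp add: is_barcode_extension_def)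
next
  case False
  then have "(compact_barcode TYPE('k) k :: 'm compacts \<Rightarrow> _) = (\<lambda>_. to_completed (abs_barcode {#}))"
    by (simp add: compact_barcode_def)
  then show ?thesis by simp
qed

theorem corollary1p1:
  fixes \<Omega> :: "'w measure"
    and X :: "nat \<Rightarrow> 'w \<Rightarrow> 'm::metric_space"
    and k :: nat
    and C :: "'m set"
    and T :: "barcode completed \<Rightarrow> 'v::banach"
  assumes "prob_space \<Omega>"
    and "\<And>i. random_element \<Omega> (X i)"
    and "prob_space.indep_vars \<Omega> (\<lambda>_. borel) X UNIV"
    and "\<And>i. distr \<Omega> borel (X i) = distr \<Omega> borel (X 0)"
    and "compact C"
    and "msupport (distr \<Omega> borel (X 0)) = C"
    and "banach_type_2 TYPE('v)"
    and "continuous_on UNIV T"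
  shows "(\<forall>n\<ge>1. pettis_integrable \<Omega> (\<lambda>\<omega>. T (compact_barcode TYPE('k::field) k (sample X n \<omega>)))) \<and>
         (\<lambda>n. pettis_integral \<Omega> (\<lambda>\<omega>. T (compact_barcode TYPE('k) k (sample X n \<omega>))))
           \<longlonglongrightarrow> T (compact_barcode TYPE('k) k (Abs_compacts C))"
proof -
  have F: "continuous_on UNIV (\<lambda>A :: 'm compacts. T (compact_barcode TYPE('k) k A))"
    by (rule continuous_on_compose2[OF assms(8) continuous_compact_barcode]) simp
  show ?thesis
    unfolding pettis_integrable_def
    using prob_space.has_pettis_integral_sample[OF assms(1-6) F]
      prob_space.pettis_integral_sample_tendsto[OF assms(1-6) F] by blast
qed

end
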